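(* Let $n\ge2$, $1\le k \le n-1$, $v\in V_{n+1, n-k}$, and let $a$ be a function on $[0,1]$ with $$\int^1_0 |a(\tau)|\, (1-\tau^2)^{(k-1)/2} \tau^{n-k-1}\, d\tau <\infty .$$ Then for any spherical harmonic $Y_j$ of degree $j$ on $S^n$, $$\int_{S^n} a(|x^T v|)\, Y_j(x)\, d_*x = \begin{cases} 0 & \text{if } j \text{ is odd},\\ \hat a(j)\, \hat Y_j (v) & \text{if } j \text{ is even},\end{cases}$$ where, for $j$ even, $$\hat a(j) = \frac{\varkappa_j\, \sigma_{n-k-1} \sigma_k}{\sigma_n\sqrt {d_n(j)}}\int^1_0 R^{(\rho,\sigma)}_{j/2} (2\tau^2-1)\, a(\tau)\, (1-\tau^2)^{(k-1)/2} \tau^{n-k-1}\, d\tau,$$ $\rho=(k-1)/2$, $\sigma=(n-k)/2-1$, and $\hat Y_j$ is the Stiefel harmonic induced by $Y_j$, $$\hat Y_j (v)= \varkappa_j \sqrt {d_n(j)}\int_{S^n} Y_j (x)\, R^{(\rho, \sigma)}_{j/2} (2|x^T v|^2-1)\, d_*x .$$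
   Context: $S^n\subset\mathbb{R}^{n+1}$ is the unit sphere, $d_*x$ its normalized (probability) surface measure, $\sigma_m=2\pi^{(m+1)/2}/\Gamma((m+1)/2)$ the area of $S^m$ (so $\sigma_0=2$; note $\sigma$ without index is a real parameter). $V_{n+1,n-k}$ is the Stiefel manifold of real $(n+1)\times(n-k)$ matrices $v$ with $v^Tv=I_{n-k}$. For $x\in S^n$ (a column vector), $|x^Tv|$ is the Euclidean norm of the row vector $x^Tv$. Constants and polynomials: $d_n(j)=(n+2j-1)\dfrac{\Gamma(n+j-1)}{\Gamma(j+1)\Gamma(n)}$ is the dimension of the space of spherical harmonics of degree $j$ on $S^n$; $R^{(\rho,\sigma)}_m(t)=P^{(\rho,\sigma)}_m(t)/P^{(\rho,\sigma)}_m(1)$ is the normalized Jacobi polynomial; for $j$ even, $$\varkappa_j=\left[\frac{\sigma_n\,(2j+n-1)\,\Gamma\left(\frac{j+k+1}{2}\right)\Gamma\left(\frac{j+n-1}{2}\right)}{\sigma_{n-k-1}\sigma_k\,\Gamma^2\left(\frac{k+1}{2}\right)\Gamma\left(\frac j2+1\right)\Gamma\left(\frac{j+n-k}{2}\right)}\right]^{1/2}.$$ *)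

theory Defs
  imports "HOL-Analysis.Analysis"
begin

text \<open>
  The normalized surface measure of the unit sphere of a Euclidean space: the measure of a
  subset \<open>A\<close> of the sphere is the proportion of the volume of the unit ball that is occupied
  by the cone \<open>{t *\<^sub>R x | t x. 0 < t \<and> t \<le> 1 \<and> x \<in> A}\<close>, i.e. the image of the uniform
  distribution on the ball under radial projection \<open>sgn x = x /\<^sub>R norm x\<close>.
  It lives on the ambient space and is concentrated on \<open>sphere 0 1\<close> (the origin, where
  \<open>sgn 0 = 0\<close>, is a null set).  It is completed, so that functions of \<open>x\<close> built from
  functions that are merely Lebesgue measurable can be integrated.
\<close>

definition sphere_measure :: "'a::euclidean_space measure" where
  "sphere_measure = completion (distr (uniform_measure lborel (cball 0 1)) borel sgn)"

text \<open>Surface area of the \<open>m\<close>-dimensional unit sphere in \<open>(m + 1)\<close>-dimensional space.\<close>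

definition sphere_area :: "nat \<Rightarrow> real" where
  "sphere_area m = 2 * pi powr ((real m + 1) / 2) / Gamma ((real m + 1) / 2)"

definition dir_deriv :: "'a \<Rightarrow> ('a::euclidean_space \<Rightarrow> complex) \<Rightarrow> 'a \<Rightarrow> complex" where
  "dir_deriv b f x = vector_derivative (\<lambda>t. f (x + t *\<^sub>R b)) (at 0)"

definition laplacian :: "('a::euclidean_space \<Rightarrow> complex) \<Rightarrow> 'a \<Rightarrow> complex" where
  "laplacian f x = (\<Sum>b\<in>Basis. dir_deriv b (dir_deriv b f) x)"

text \<open>
  Only the values of \<open>Y\<close> on the unit sphere matter.  The zero function is included, so that
  the spherical harmonics of a given degree form a vector space.
\<close>

definition spherical_harmonic :: "nat \<Rightarrow> ('a::euclidean_space \<Rightarrow> complex) \<Rightarrow> bool" where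
  "spherical_harmonic j Y \<longleftrightarrow>
     (\<exists>p. polynomial_function p \<and>
          (\<forall>c x. p (c *\<^sub>R x) = c ^ j *\<^sub>R p x) \<and>
          (\<forall>x. laplacian p x = 0) \<and>
          (\<forall>x\<in>sphere 0 1. Y x = p x))"

text \<open>Dimension of the space of spherical harmonics of degree \<open>j\<close> on the \<open>n\<close>-sphere.\<close>

definition harm_dim :: "nat \<Rightarrow> nat \<Rightarrow> real" where
  "harm_dim n j = (real n + 2 * real j - 1) *
     (Gamma (real n + real j - 1) / (Gamma (real j + 1) * Gamma (real n)))"

text \<open>The standard normalization, with value \<open>(m + \<alpha>) gchoose m\<close> at \<open>1\<close>.\<close>

definition jacobi_poly :: "real \<Rightarrow> real \<Rightarrow> nat \<Rightarrow> real \<Rightarrow> real" where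
  "jacobi_poly \<alpha> \<beta> m t =
     (\<Sum>s\<le>m. ((real m + \<alpha>) gchoose (m - s)) * ((real m + \<beta>) gchoose s) *
              ((t - 1) / 2) ^ s * ((t + 1) / 2) ^ (m - s))"

definition jacobi_normalized :: "real \<Rightarrow> real \<Rightarrow> nat \<Rightarrow> real \<Rightarrow> real" where
  "jacobi_normalized \<alpha> \<beta> m t = jacobi_poly \<alpha> \<beta> m t / jacobi_poly \<alpha> \<beta> m 1"

text \<open>
  The type \<open>real ^ 'm ^ 'n\<close> consists of the matrices with \<open>CARD('n)\<close> rows and \<open>CARD('m)\<close>
  columns; for such a matrix \<open>v\<close>, the row vector \<open>x\<^sup>T v\<close> is \<open>x v* v\<close>.
\<close>

definition stiefel :: "(real ^ 'm ^ 'n) set" where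
  "stiefel = {v. transpose v ** v = mat 1}"

text \<open>Used only for \<open>k < n\<close>, so the subtraction \<open>n - k - 1\<close> on naturals below is the true one.\<close>

definition kappa :: "nat \<Rightarrow> nat \<Rightarrow> nat \<Rightarrow> real" where
  "kappa n k j = sqrt
     ((sphere_area n * (2 * real j + real n - 1) *
       Gamma ((real j + real k + 1) / 2) * Gamma ((real j + real n - 1) / 2)) /
      (sphere_area (n - k - 1) * sphere_area k * (Gamma ((real k + 1) / 2))\<^sup>2 *
       Gamma (real j / 2 + 1) * Gamma ((real j + real n - real k) / 2)))"

text \<open>Used for even \<open>j\<close> only, so \<open>j div 2\<close> is exact.\<close>

definition zonal :: "nat \<Rightarrow> nat \<Rightarrow> nat \<Rightarrow> real \<Rightarrow> real" where
  "zonal n k j \<tau> =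
     jacobi_normalized ((real k - 1) / 2) ((real n - real k) / 2 - 1) (j div 2) (2 * \<tau>\<^sup>2 - 1)"

definition weight :: "nat \<Rightarrow> nat \<Rightarrow> real \<Rightarrow> real" where
  "weight n k \<tau> = (1 - \<tau>\<^sup>2) powr ((real k - 1) / 2) * \<tau> ^ (n - k - 1)"

definition multiplier :: "nat \<Rightarrow> nat \<Rightarrow> (real \<Rightarrow> complex) \<Rightarrow> nat \<Rightarrow> complex" where
  "multiplier n k a j =
     (kappa n k j * sphere_area (n - k - 1) * sphere_area k /
        (sphere_area n * sqrt (harm_dim n j))) *\<^sub>R
     (LINT \<tau>:{0..1}|lebesgue. (zonal n k j \<tau> * weight n k \<tau>) *\<^sub>R a \<tau>)"

definition stiefel_harmonic ::
    "nat \<Rightarrow> nat \<Rightarrow> nat \<Rightarrow> (real ^ 'n \<Rightarrow> complex) \<Rightarrow> real ^ 'm ^ 'n \<Rightarrow> complex" where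
  "stiefel_harmonic n k j Y v =
     (kappa n k j * sqrt (harm_dim n j)) *\<^sub>R
     (LINT x:sphere 0 1|sphere_measure. zonal n k j (norm (x v* v)) *\<^sub>R Y x)"

end

theory Submission
  imports Defs "HOL-Probability.Probability_Measure"
begin

text \<open>
  The function \<open>a (norm (x v* v))\<close> depends only on the length \<open>norm (x v* v)\<close> of the projection of \<open>x\<close>
  to the column space of \<open>v\<close>. So the integral on the left is an integral of \<open>a\<close> against the
  complex measure on \<open>[0, 1]\<close> that is the image, under \<open>x \<mapsto> norm (x v* v)\<close>, of the measure with
  density \<open>Y\<close> on the sphere. The theorem says that this image has the density
  \<open>zonal n k j * weight n k\<close>, up to a factor that depends on \<open>Y\<close> and \<open>v\<close> but not on \<open>a\<close>, and that
  it is zero if \<open>j\<close> is odd. The factor is not computed: applied to the profile \<open>zonal n k j\<close>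
  instead of \<open>a\<close>, the same statement expresses the Stiefel harmonic by it, and the two formulas
  combine to the claim because \<open>kappa n k j\<close> normalizes the Jacobi polynomial
  (\<open>kappa_normalization\<close>).

  The image measure is identified by its even moments
  \<open>\<integral> norm (x v* v) ^ (2 * s) * Y x\<close>, which suffice on \<open>[0, 1]\<close> by the Weierstrass theorem
  (\<open>finite_measure_eqI_even_moments\<close>). The power \<open>norm (x v* v) ^ (2 * s)\<close> is a homogeneous
  polynomial whose Laplacian is a multiple of \<open>norm (x v* v) ^ (2 * (s - 1))\<close>. Green's identity on
  the sphere for this polynomial and a harmonic polynomial therefore gives a two-term recurrence
  for the moments (\<open>sphere_moment_recurrence\<close>), which determines them up to one factor and forces
  them to vanish in odd degree. The moments of \<open>zonal n k j * weight n k\<close> have a closed form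
  (\<open>has_bochner_integral_jacobi_moment\<close>), satisfy the same recurrence, and so are proportional to
  them (\<open>sphere_moment_eq_jacobi_moment\<close>). The constant function \<open>Y = 1\<close>, the case \<open>j = 0\<close>,
  yields the law of the projected length itself (\<open>distr_norm_vector_matrix_sphere\<close>); this law
  gives integrability, and shows that \<open>a\<close> may be changed on a null set.

  Green's identity on the sphere is deduced from the vanishing of integrals of directional
  derivatives over the whole space, with a cutoff supported in the ball
  (\<open>green_identity_ball\<close>), and from the relation between integrals of homogeneous functions over
  the ball and over the sphere (\<open>integral_cball_homogeneous\<close>). No surface integrals or polar
  coordinates are involved.
\<close>

section \<open>Homogeneous functions on the ball and on the sphere\<close>

lemma integral_lborel_scale:
  fixes f :: "'a::euclidean_space \<Rightarrow> complex"
  assumes c: "c > 0" and f [measurable]: "f \<in> borel_measurable borel"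
  shows "integral\<^sup>L lborel f = (c ^ DIM('a)) *\<^sub>R (\<integral>x. f (c *\<^sub>R x) \<partial>lborel)"
proof -
  have "integral\<^sup>L lborel f
      = integral\<^sup>L (density (distr lborel borel (\<lambda>x. 0 + c *\<^sub>R x)) (\<lambda>_. \<bar>c\<bar>^DIM('a))) f"
    using lborel_affine[of c "0::'a"] c by simp
  also have "\<dots> = integral\<^sup>L (distr lborel borel (\<lambda>x. 0 + c *\<^sub>R x)) (\<lambda>x. (c ^ DIM('a)) *\<^sub>R f x)"
    using c by (subst integral_density) auto
  also have "\<dots> = (c ^ DIM('a)) *\<^sub>R (\<integral>x. f (c *\<^sub>R x) \<partial>lborel)"
    by (subst integral_distr) auto
  finally show ?thesis .
qed

lemma borel_measurable_sgn [measurable]: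
  "(sgn :: 'a::euclidean_space \<Rightarrow> 'a) \<in> borel_measurable borel"
  unfolding sgn_div_norm[abs_def] by measurable

lemma integrable_lborel_cball_bounded:
  fixes f :: "'a::euclidean_space \<Rightarrow> 'b::{banach, second_countable_topology}"
  assumes "f \<in> borel_measurable borel" and "\<And>x. norm x \<le> 1 \<Longrightarrow> norm (f x) \<le> K"
  shows "integrable lborel (\<lambda>x. indicator (cball 0 1) x *\<^sub>R f x)"
proof (rule Bochner_Integration.integrable_bound)
  show "integrable lborel (\<lambda>x::'a. indicator (cball 0 1) x * K)"
    by (intro integrable_mult_left integrable_real_indicator)
       (use emeasure_compact_finite[of "cball 0 1 :: 'a set"] in auto)
  show "(\<lambda>x. indicator (cball 0 1) x *\<^sub>R f x) \<in> borel_measurable lborel"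
    using assms(1) by (intro borel_measurable_scaleR borel_measurable_indicator) auto
qed (use assms(2) in \<open>force split: split_indicator\<close>)

text \<open>
  Integration in polar coordinates, without polar coordinates. By scaling, the integrals over the
  shell between radii \<open>r\<close> and \<open>1\<close> of \<open>q\<close> and of \<open>q \<circ> sgn\<close> are \<open>1 - r ^ (N + d)\<close> and
  \<open>1 - r ^ N\<close> times their integrals over the ball, where \<open>N\<close> is the dimension. On a thin
  shell the two integrands are uniformly close, so after division by \<open>1 - r\<close> the two sides
  agree in the limit \<open>r \<rightarrow> 1\<close>.
\<close>

lemma integral_cball_homogeneous:
  fixes q :: "'a::euclidean_space \<Rightarrow> complex"
  assumes cont: "continuous_on UNIV q" and hom: "\<And>c x. q (c *\<^sub>R x) = c ^ d *\<^sub>R q x"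
  shows "real (DIM('a) + d) *\<^sub>R (\<integral>x. indicator (cball 0 1) x *\<^sub>R q x \<partial>lborel)
       = real DIM('a) *\<^sub>R (\<integral>x. indicator (cball 0 1) x *\<^sub>R q (sgn x) \<partial>lborel)"
proof -
  define N where "N = DIM('a)"
  let ?B = "cball 0 1 :: 'a set"
  define A where "A = (\<integral>x. indicator ?B x *\<^sub>R q x \<partial>lborel)"
  define H where "H = (\<integral>x. indicator ?B x *\<^sub>R q (sgn x) \<partial>lborel)"
  define V where "V = (\<integral>x. indicator ?B x *\<^sub>R (1::complex) \<partial>lborel)"
  have [measurable]: "q \<in> borel_measurable borel"
    using cont by (rule borel_measurable_continuous_onI)
  have "compact (q ` ?B)"
    using cont by (intro compact_continuous_image) (auto intro: continuous_on_subset)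
  then obtain K where K: "\<And>x. x \<in> ?B \<Longrightarrow> norm (q x) \<le> K"
    using compact_imp_bounded[of "q ` ?B"] unfolding bounded_iff by blast
  have K0: "K \<ge> 0" using K[of 0] norm_ge_zero[of "q 0"] by (simp del: norm_ge_zero)
  have sgnB: "norm (sgn x) \<le> 1" for x :: 'a by (simp add: norm_sgn)
  \<comment> \<open>The geometric sums are the quotients by \<open>1 - r\<close> of \<open>1 - r ^ (N + d)\<close> and \<open>1 - r ^ N\<close>.\<close>
  have shell: "norm ((\<Sum>i<N + d. r ^ i) *\<^sub>R A - (\<Sum>i<N. r ^ i) *\<^sub>R H)
      \<le> (1 - r ^ d) * K * ((\<Sum>i<N. r ^ i) * norm V)" if l: "0 < r" "r < 1" for r
  proof -
    have [measurable]: "(\<lambda>x. indicator ?B (x /\<^sub>R r) :: real) \<in> borel_measurable borel"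
      by (rule measurable_compose[where g="indicator ?B" and N=borel])
         (auto intro!: borel_measurable_indicator)
    have scale: "(\<integral>x. indicator ?B (x /\<^sub>R r) *\<^sub>R g x \<partial>lborel)
        = r ^ (N + e) *\<^sub>R (\<integral>x. indicator ?B x *\<^sub>R g x \<partial>lborel)"
      if [measurable]: "g \<in> borel_measurable borel" and "\<And>x. g (r *\<^sub>R x) = r ^ e *\<^sub>R g x"
      for g :: "'a \<Rightarrow> complex" and e
    proof -
      have "(\<integral>x. indicator ?B (x /\<^sub>R r) *\<^sub>R g x \<partial>lborel)
          = r ^ N *\<^sub>R (\<integral>x. indicator ?B x *\<^sub>R (r ^ e *\<^sub>R g x) \<partial>lborel)"
        using l that by (subst integral_lborel_scale[of r]) (auto simp: N_def)
      also have "(\<integral>x. indicator ?B x *\<^sub>R (r ^ e *\<^sub>R g x) \<partial>lborel)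
          = (\<integral>x. r ^ e *\<^sub>R (indicator ?B x *\<^sub>R g x) \<partial>lborel)"
        by (simp add: mult.commute)
      also have "\<dots> = r ^ e *\<^sub>R (\<integral>x. indicator ?B x *\<^sub>R g x \<partial>lborel)"
        by (rule integral_scaleR_right)
      finally show ?thesis by (simp add: power_add)
    qed
    let ?S = "\<lambda>x. indicator ?B x - indicator ?B (x /\<^sub>R r) :: real"
    have sub: "x \<in> ?B" if "x /\<^sub>R r \<in> ?B" for x
    proof -
      have "norm x = r * norm (x /\<^sub>R r)" using l by simp
      also have "\<dots> \<le> 1 * 1" using that l by (intro mult_mono) auto
      finally show ?thesis by simp
    qed
    have intg: "integrable lborel (\<lambda>x. indicator ?B x *\<^sub>R g x)"
       "integrable lborel (\<lambda>x. indicator ?B (x /\<^sub>R r) *\<^sub>R g x)"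
      if [measurable]: "g \<in> borel_measurable borel" and "\<And>x. x \<in> ?B \<Longrightarrow> norm (g x) \<le> L"
      for g :: "'a \<Rightarrow> complex" and L
    proof -
      show 1: "integrable lborel (\<lambda>x. indicator ?B x *\<^sub>R g x)"
        using that by (intro integrable_lborel_cball_bounded) auto
      have sub': "indicator ?B (x /\<^sub>R r) \<le> (indicator ?B x :: real)" for x
        using sub[of x] by (auto split: split_indicator)
      show "integrable lborel (\<lambda>x. indicator ?B (x /\<^sub>R r) *\<^sub>R g x)"
        by (rule Bochner_Integration.integrable_bound[OF 1])
           (auto intro!: AE_I2 mult_right_mono sub')
    qed
    have shl: "(\<integral>x. ?S x *\<^sub>R g x \<partial>lborel)
        = (1 - r ^ (N + e)) *\<^sub>R (\<integral>x. indicator ?B x *\<^sub>R g x \<partial>lborel)"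
      if "g \<in> borel_measurable borel" "\<And>x. g (r *\<^sub>R x) = r ^ e *\<^sub>R g x"
        "\<And>x. x \<in> ?B \<Longrightarrow> norm (g x) \<le> L" for g :: "'a \<Rightarrow> complex" and e L
      using intg[of g L] that scale[of g e]
      by (simp add: scaleR_diff_left Bochner_Integration.integral_diff)
    have m1: "(\<lambda>x. q (sgn x)) \<in> borel_measurable borel" by measurable
    have sg: "sgn (r *\<^sub>R x) = sgn x" for x :: 'a using l by (simp add: sgn_scaleR)
    have eA: "(\<integral>x. ?S x *\<^sub>R q x \<partial>lborel) = (1 - r ^ (N + d)) *\<^sub>R A"
      unfolding A_def by (rule shl[of q _ K]) (use hom K in auto)
    have eH: "(\<integral>x. ?S x *\<^sub>R q (sgn x) \<partial>lborel) = (1 - r ^ N) *\<^sub>R H"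
      unfolding H_def using shl[of "\<lambda>x. q (sgn x)" 0 K] m1 K sgnB sg by (simp add: norm_sgn)
    have eV: "(\<integral>x. ?S x *\<^sub>R (1::complex) \<partial>lborel) = (1 - r ^ N) *\<^sub>R V"
      unfolding V_def using shl[of "\<lambda>x. 1" 0 1] by simp
    have iq: "integrable lborel (\<lambda>x. ?S x *\<^sub>R q x)"
      using intg[of q K] K by (simp add: scaleR_diff_left)
    have ih: "integrable lborel (\<lambda>x. ?S x *\<^sub>R q (sgn x))"
      using intg[of "\<lambda>x. q (sgn x)" K] K sgnB m1 by (simp add: scaleR_diff_left)
    have i1: "integrable lborel (\<lambda>x. ?S x *\<^sub>R (1::complex))"
      using intg[of "\<lambda>x. 1" 1] by (simp only: scaleR_diff_left) auto
    have S0: "?S x \<ge> 0" for x using sub[of x] by (auto split: split_indicator)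
    \<comment> \<open>By homogeneity \<open>q\<close> and \<open>q \<circ> sgn\<close> differ by the factor \<open>norm x ^ d\<close>, which lies between \<open>r ^ d\<close> and \<open>1\<close> on the shell.\<close>
    have pw: "norm (?S x *\<^sub>R q x - ?S x *\<^sub>R q (sgn x)) \<le> ((1 - r ^ d) * K) * ?S x" for x
    proof (cases "?S x = 0")
      case False
      then have x: "norm x \<le> 1" "r < norm x" "?S x = 1"
        using sub[of x] l by (auto split: split_indicator_asm simp: field_simps)
      have "norm x \<noteq> 0" using x l by linarith
      then have "norm x *\<^sub>R sgn x = x"
        by (simp add: sgn_div_norm)
      then have "q x = norm x ^ d *\<^sub>R q (sgn x)"
        using hom[of "norm x" "sgn x"] by simp
      then have "norm (q x - q (sgn x)) = norm ((1 - norm x ^ d) *\<^sub>R q (sgn x))"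
        by (simp add: scaleR_diff_left norm_minus_commute)
      also have "\<dots> = (1 - norm x ^ d) * norm (q (sgn x))"
        using x by (simp add: power_le_one)
      also have "\<dots> \<le> (1 - r ^ d) * K"
        using x l K[of "sgn x"] sgnB[of x] by (intro mult_mono) (auto intro: power_mono power_le_one)
      finally show ?thesis using x by simp
    qed simp
    have "norm ((1 - r ^ (N + d)) *\<^sub>R A - (1 - r ^ N) *\<^sub>R H)
        = norm (\<integral>x. ?S x *\<^sub>R q x - ?S x *\<^sub>R q (sgn x) \<partial>lborel)"
      using iq ih by (simp only: Bochner_Integration.integral_diff eA eH)
    also have "\<dots> \<le> (\<integral>x. ((1 - r ^ d) * K) * ?S x \<partial>lborel)"
    proof (rule Bochner_Integration.integral_norm_bound_integral)
      show "integrable lborel (\<lambda>x. ((1 - r ^ d) * K) * ?S x)"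
        using i1 integrable_norm[OF i1] S0 by (intro integrable_mult_right) (simp add: abs_of_nonneg)
    qed (use iq ih pw in auto)
    also have "\<dots> = ((1 - r ^ d) * K) * (\<integral>x. norm (?S x *\<^sub>R (1::complex)) \<partial>lborel)"
      using S0 by (simp add: abs_of_nonneg)
    also have "(\<integral>x. norm (?S x *\<^sub>R (1::complex)) \<partial>lborel) = norm (\<integral>x. ?S x *\<^sub>R (1::complex) \<partial>lborel)"
    proof -
      have "(\<integral>x. ?S x *\<^sub>R (1::complex) \<partial>lborel) = complex_of_real (\<integral>x. ?S x \<partial>lborel)"
        by (subst integral_complex_of_real[symmetric]) (simp add: scaleR_conv_of_real)
      moreover have "(\<integral>x. ?S x \<partial>lborel) \<ge> 0"
        by (rule Bochner_Integration.integral_nonneg) (rule S0)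
      ultimately show ?thesis using S0 by (simp add: abs_of_nonneg)
    qed
    also have "\<dots> = (1 - r ^ N) * norm V"
      unfolding eV using l by (simp add: power_le_one)
    finally have "norm ((1 - r ^ (N + d)) *\<^sub>R A - (1 - r ^ N) *\<^sub>R H)
        \<le> (1 - r ^ d) * K * ((1 - r ^ N) * norm V)" .
    moreover have "1 - r ^ e = (1 - r) * (\<Sum>i<e. r ^ i)" for e
      by (rule one_diff_power_eq)
    ultimately have "norm ((1 - r) *\<^sub>R ((\<Sum>i<N + d. r ^ i) *\<^sub>R A - (\<Sum>i<N. r ^ i) *\<^sub>R H))
        \<le> (1 - r) * ((1 - r ^ d) * K * ((\<Sum>i<N. r ^ i) * norm V))"
      by (simp add: scaleR_diff_right mult_ac)
    then show ?thesis using l by (simp add: mult_le_cancel_left)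
  qed
  have "norm ((\<Sum>i<N + d. 1 ^ i) *\<^sub>R A - (\<Sum>i<N. 1 ^ i) *\<^sub>R H)
      \<le> (1 - 1 ^ d) * K * ((\<Sum>i<N. 1 ^ i) * norm V)"
  proof (rule tendsto_le)
    show "((\<lambda>r. (1 - r ^ d) * K * ((\<Sum>i<N. r ^ i) * norm V)) \<longlongrightarrow>
      (1 - 1 ^ d) * K * ((\<Sum>i<N. 1 ^ i) * norm V)) (at_left (1::real))"
      by (intro tendsto_intros)
    show "((\<lambda>r. norm ((\<Sum>i<N + d. r ^ i) *\<^sub>R A - (\<Sum>i<N. r ^ i) *\<^sub>R H)) \<longlongrightarrow>
      norm ((\<Sum>i<N + d. 1 ^ i) *\<^sub>R A - (\<Sum>i<N. 1 ^ i) *\<^sub>R H)) (at_left (1::real))"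
      by (intro tendsto_intros)
    show "\<forall>\<^sub>F r in at_left 1. norm ((\<Sum>i<N + d. r ^ i) *\<^sub>R A - (\<Sum>i<N. r ^ i) *\<^sub>R H)
      \<le> (1 - r ^ d) * K * ((\<Sum>i<N. r ^ i) * norm V)"
      using eventually_at_left_real[OF zero_less_one] by eventually_elim (use shell in auto)
  qed simp
  then show ?thesis by (simp add: A_def H_def N_def)
qed

text \<open>
  The surface measure before completion: on Borel sets, image measures, densities and
  approximation arguments apply directly.
\<close>

definition sphere_borel :: "'a::euclidean_space measure" where
  "sphere_borel = distr (uniform_measure lborel (cball 0 1)) borel sgn"

lemma sets_sphere_borel [simp, measurable_cong]: "sets sphere_borel = sets borel"
  and space_sphere_borel [simp]: "space sphere_borel = UNIV"
  by (simp_all add: sphere_borel_def)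

lemma measurable_sphere_borel_eq [simp]: "borel_measurable sphere_borel = borel_measurable borel"
  by (rule measurable_cong_sets) simp_all

lemma measure_unit_cball_pos: "0 < measure lborel (cball 0 1 :: 'a::euclidean_space set)"
  by (simp add: content_cball unit_ball_vol_pos)

lemma prob_space_sphere_borel: "prob_space (sphere_borel :: 'a::euclidean_space measure)"
proof -
  have "emeasure lborel (cball 0 1 :: 'a set) \<noteq> 0" "emeasure lborel (cball 0 1 :: 'a set) \<noteq> \<infinity>"
    using measure_unit_cball_pos[where 'a='a] emeasure_compact_finite[of "cball 0 1 :: 'a set"]
    by (auto simp: measure_def)
  then interpret U: prob_space "uniform_measure lborel (cball 0 1 :: 'a set)"
    by (rule prob_space_uniform_measure)
  show ?thesis unfolding sphere_borel_def by (rule U.prob_space_distr) simp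
qed

lemma AE_sphere_borel_norm: "AE x in (sphere_borel :: 'a::euclidean_space measure). norm x = 1"
proof -
  have "AE x in uniform_measure lborel (cball 0 1 :: 'a set). norm (sgn x) = 1"
    using AE_lborel_singleton[of "0::'a"]
    by (intro AE_uniform_measureI) (auto simp: norm_sgn elim!: eventually_mono)
  then show ?thesis
    unfolding sphere_borel_def by (subst AE_distr_iff) auto
qed

lemma integral_sphere_borel:
  fixes q :: "'a::euclidean_space \<Rightarrow> complex"
  assumes [measurable]: "q \<in> borel_measurable borel"
  shows "(\<integral>x. indicator (cball 0 1) x *\<^sub>R q (sgn x) \<partial>lborel)
       = measure lborel (cball 0 1 :: 'a set) *\<^sub>R (\<integral>x. q x \<partial>sphere_borel)"
proof -
  let ?V = "measure lborel (cball 0 1 :: 'a set)"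
  have V: "emeasure lborel (cball 0 1 :: 'a set) = ennreal ?V"
    using emeasure_compact_finite[of "cball 0 1 :: 'a set"] by (intro emeasure_eq_ennreal_measure) auto
  have U: "uniform_measure lborel (cball 0 1 :: 'a set) = density lborel (\<lambda>x. ennreal (indicator (cball 0 1) x / ?V))"
    unfolding uniform_measure_def V
    using measure_unit_cball_pos[where 'a='a]
    by (intro arg_cong[where f="density lborel"] ext)
       (auto split: split_indicator simp: divide_ennreal[symmetric])
  have "(\<integral>x. q x \<partial>sphere_borel) = (\<integral>x. (indicator (cball 0 1) x / ?V) *\<^sub>R q (sgn x) \<partial>lborel)"
    unfolding sphere_borel_def U
    by (subst integral_distr, simp, simp, subst integral_density)
       (auto intro!: borel_measurable_divide borel_measurable_indicator)
  also have "\<dots> = (\<integral>x. (1 / ?V) *\<^sub>R (indicator (cball 0 1) x *\<^sub>R q (sgn x)) \<partial>lborel)"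
    by simp
  also have "\<dots> = (1 / ?V) *\<^sub>R (\<integral>x. indicator (cball 0 1) x *\<^sub>R q (sgn x) \<partial>lborel)"
    by (rule integral_scaleR_right)
  finally show ?thesis using measure_unit_cball_pos[where 'a='a] by simp
qed

section \<open>Green's identity on the sphere\<close>

lemma has_field_derivative_max_0_power2:
  "((\<lambda>y. (max 0 y)\<^sup>2) has_real_derivative 2 * max 0 y) (at (y::real))"
proof -
  consider "y > 0" | "y < 0" | "y = 0" by linarith
  then show ?thesis
  proof cases
    case 1
    have "((\<lambda>y. y\<^sup>2) has_real_derivative 2 * max 0 y) (at y)"
      using 1 by (auto intro!: derivative_eq_intros)
    then show ?thesis
      by (rule has_field_derivative_transform_within_open[where S="{0<..}"]) (use 1 in auto)
  next
    case 2
    have "((\<lambda>y. 0) has_real_derivative 2 * max 0 y) (at y)"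
      using 2 by (auto intro!: derivative_eq_intros)
    then show ?thesis
      by (rule has_field_derivative_transform_within_open[where S="{..<0}"]) (use 2 in auto)
  next
    case 3
    have "((\<lambda>h::real. \<bar>h\<bar>) \<longlongrightarrow> 0) (at 0)"
      by (rule tendsto_rabs_zero[OF tendsto_ident_at])
    then have "((\<lambda>h::real. (max 0 h)\<^sup>2 / h) \<longlongrightarrow> 0) (at 0)"
      by (rule Lim_null_comparison[rotated])
         (auto simp: max_def power2_eq_square)
    then show ?thesis using 3 by (simp add: DERIV_def)
  qed
qed

text \<open>
  By translation invariance every difference quotient of \<open>G\<close> in the direction \<open>b\<close> has integral
  \<open>0\<close>. The quotients are bounded by a Lipschitz constant and supported in a fixed ball, so
  dominated convergence applies.
\<close>

lemma integral_directional_derivative_eq_0: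
  fixes G G' :: "'a::euclidean_space \<Rightarrow> complex"
  assumes der: "\<And>x. ((\<lambda>t. G (x + t *\<^sub>R b)) has_vector_derivative G' x) (at 0)"
    and G: "continuous_on UNIV G" and G': "continuous_on UNIV G'"
    and supp: "\<And>x. norm x > R \<Longrightarrow> G x = 0" "\<And>x. norm x > R \<Longrightarrow> G' x = 0"
  shows "(\<integral>x. G' x \<partial>lborel) = 0"
proof -
  have [measurable]: "G \<in> borel_measurable borel" "G' \<in> borel_measurable borel"
    using G G' by (auto intro: borel_measurable_continuous_onI)
  have "compact (G' ` cball 0 R)"
    using G' by (intro compact_continuous_image) (auto intro: continuous_on_subset)
  then obtain L0 where "\<And>x. x \<in> cball 0 R \<Longrightarrow> norm (G' x) \<le> L0"
    using compact_imp_bounded[of "G' ` cball 0 R"] unfolding bounded_iff by blast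
  then have L: "norm (G' x) \<le> max 0 L0" for x
    using supp(2)[of x] by (cases "norm x \<le> R") (auto intro: max.coboundedI2)
  define L where "L = max 0 L0"
  have L0: "L \<ge> 0" by (simp add: L_def)
  have lip: "norm (G (x + t *\<^sub>R b) - G x) \<le> L * \<bar>t\<bar>" for x t
  proof -
    have d: "((\<lambda>s. G (x + s *\<^sub>R b)) has_derivative (\<lambda>h. h *\<^sub>R G' (x + s *\<^sub>R b))) (at s within UNIV)" for s
    proof -
      have 1: "((\<lambda>h. G ((x + s *\<^sub>R b) + h *\<^sub>R b)) has_vector_derivative G' (x + s *\<^sub>R b)) (at (s - s))"
        using der[of "x + s *\<^sub>R b"] by simp
      have 2: "((\<lambda>r. r - s) has_vector_derivative 1) (at s)"
        by (auto intro!: derivative_eq_intros)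
      have "((\<lambda>r. G (x + r *\<^sub>R b)) has_vector_derivative G' (x + s *\<^sub>R b)) (at s)"
        using vector_diff_chain_at[of "\<lambda>r. r - s", OF 2 1] by (simp add: o_def algebra_simps)
      then show ?thesis by (simp add: has_vector_derivative_def)
    qed
    have "norm (G (x + t *\<^sub>R b) - G (x + 0 *\<^sub>R b)) \<le> L * norm (t - 0)"
      by (rule differentiable_bound[OF _ d])
         (auto intro!: onorm_le mult_left_mono L simp: L_def mult.commute)
    then show ?thesis by simp
  qed
  have intG: "integrable lborel (\<lambda>x. G (c + x))" for c
  proof -
    have "integrable lborel (\<lambda>x. indicator (cball (- c) R) x *\<^sub>R G (c + x))"
      by (intro borel_integrable_compact) (auto intro!: continuous_intros continuous_on_compose2[OF G])
    moreover have "indicator (cball (- c) R) x *\<^sub>R G (c + x) = G (c + x)" for x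
      using supp(1)[of "c + x"] by (auto split: split_indicator simp: dist_norm norm_minus_commute add.commute)
    ultimately show ?thesis by simp
  qed
  define Q where "Q = (\<lambda>i x. real (Suc i) *\<^sub>R (G ((1 / real (Suc i)) *\<^sub>R b + x) - G x))"
  have Q0: "integral\<^sup>L lborel (Q i) = 0" for i
  proof -
    have "(\<integral>x. G ((1 / real (Suc i)) *\<^sub>R b + x) \<partial>lborel) = integral\<^sup>L (distr lborel borel ((+) ((1 / real (Suc i)) *\<^sub>R b))) G"
      by (rule integral_distr[symmetric]) auto
    also have "\<dots> = integral\<^sup>L lborel G" by (simp only: lborel_distr_plus)
    finally show ?thesis
      unfolding Q_def using intG[of 0] intG[of "(1 / real (Suc i)) *\<^sub>R b"] by simp
  qed
  have "(\<lambda>i. integral\<^sup>L lborel (Q i)) \<longlonglongrightarrow> (\<integral>x. G' x \<partial>lborel)"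
  proof (rule integral_dominated_convergence)
    show "integrable lborel (\<lambda>x::'a. indicator (cball 0 (R + norm b)) x * L)"
      using emeasure_compact_finite[of "cball 0 (R + norm b)"]
      by (intro integrable_mult_left integrable_real_indicator) auto
    show "AE x in lborel. (\<lambda>i. Q i x) \<longlonglongrightarrow> G' x"
    proof (rule AE_I2)
      fix x
      have "((\<lambda>h. (G (x + h *\<^sub>R b) - G x) /\<^sub>R h) \<longlongrightarrow> G' x) (at 0)"
      proof -
        have "((\<lambda>h. norm (G (x + h *\<^sub>R b) - G x - h *\<^sub>R G' x) / norm h) \<longlongrightarrow> 0) (at 0)"
          using der[of x] by (simp add: has_vector_derivative_def has_derivative_at)
        moreover have "\<forall>\<^sub>F h in at 0. norm (G (x + h *\<^sub>R b) - G x - h *\<^sub>R G' x) / norm h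
            = norm ((G (x + h *\<^sub>R b) - G x) /\<^sub>R h - G' x)"
        proof (rule eventually_mono)
          show "\<forall>\<^sub>F h::real in at 0. h \<noteq> 0" by (simp add: eventually_at_filter)
          fix h :: real assume "h \<noteq> 0"
          then have "(G (x + h *\<^sub>R b) - G x) /\<^sub>R h - G' x
              = (1 / h) *\<^sub>R (G (x + h *\<^sub>R b) - G x - h *\<^sub>R G' x)"
            by (simp add: scaleR_diff_right inverse_eq_divide)
          then show "norm (G (x + h *\<^sub>R b) - G x - h *\<^sub>R G' x) / norm h
            = norm ((G (x + h *\<^sub>R b) - G x) /\<^sub>R h - G' x)"
            by (simp only: norm_scaleR) (simp add: norm_divide)
        qed
        ultimately have "((\<lambda>h. norm ((G (x + h *\<^sub>R b) - G x) /\<^sub>R h - G' x)) \<longlongrightarrow> 0) (at 0)"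
          by (rule Lim_transform_eventually)
        then show ?thesis by (rule Lim_null[THEN iffD2, OF tendsto_norm_zero_cancel])
      qed
      moreover have "filterlim (\<lambda>i. 1 / real (Suc i)) (at 0) sequentially"
        unfolding filterlim_at using LIMSEQ_inverse_real_of_nat by (auto simp: inverse_eq_divide)
      ultimately have "(\<lambda>i. (G (x + (1 / real (Suc i)) *\<^sub>R b) - G x) /\<^sub>R (1 / real (Suc i))) \<longlonglongrightarrow> G' x"
        by (rule filterlim_compose)
      then show "(\<lambda>i. Q i x) \<longlonglongrightarrow> G' x"
        by (simp add: Q_def add.commute)
    qed
    show "AE x in lborel. norm (Q i x) \<le> indicator (cball 0 (R + norm b)) x * L" for i
    proof (rule AE_I2)
      fix x
      have "norm (Q i x) = real (Suc i) * norm (G (x + (1 / real (Suc i)) *\<^sub>R b) - G x)"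
        unfolding Q_def by (simp only: norm_scaleR abs_of_nat add.commute)
      also have "\<dots> \<le> real (Suc i) * (L * \<bar>1 / real (Suc i)\<bar>)"
        by (intro mult_left_mono lip) auto
      also have "\<dots> = L" by (simp add: field_simps)
      finally have 1: "norm (Q i x) \<le> L" .
      show "norm (Q i x) \<le> indicator (cball 0 (R + norm b)) x * L"
      proof (cases "x \<in> cball 0 (R + norm b)")
        case False
        have "norm ((1 / real (Suc i)) *\<^sub>R b) \<le> 1 * norm b"
          unfolding norm_scaleR by (intro mult_right_mono) auto
        moreover have "norm x \<le> norm ((1 / real (Suc i)) *\<^sub>R b + x) + norm ((1 / real (Suc i)) *\<^sub>R b)"
          by (metis add_diff_cancel_left' norm_triangle_ineq4)
        ultimately have "norm ((1 / real (Suc i)) *\<^sub>R b + x) > R" "norm x > R"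
          using False by (auto simp del: norm_scaleR) (smt (verit) norm_ge_zero)
        then show ?thesis using False supp(1) by (simp add: Q_def)
      qed (use 1 in simp)
    qed
  qed (auto simp: Q_def)
  then show ?thesis using Q0 by (simp add: LIMSEQ_const_iff)
qed

lemma integrable_cball_continuous:
  fixes q :: "'a::euclidean_space \<Rightarrow> complex"
  assumes "continuous_on UNIV q"
  shows "integrable lborel (\<lambda>x. indicator (cball 0 1) x *\<^sub>R q x)"
  using assms by (intro borel_integrable_compact) (auto intro: continuous_on_subset)

lemma integral_cball_homogeneous_even_power:
  fixes q :: "'a::euclidean_space \<Rightarrow> complex"
  assumes cont: "continuous_on UNIV q" and hom: "\<And>c x. q (c *\<^sub>R x) = c ^ d *\<^sub>R q x"
  shows "(\<integral>x. indicator (cball 0 1) x *\<^sub>R (norm x ^ (2 * i) *\<^sub>R q x) \<partial>lborel)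
       = (real DIM('a) * measure lborel (cball 0 1 :: 'a set) / real (DIM('a) + d + 2 * i))
           *\<^sub>R (\<integral>x. q x \<partial>sphere_borel)"
proof -
  have [measurable]: "q \<in> borel_measurable borel"
    using cont by (rule borel_measurable_continuous_onI)
  have "real (DIM('a) + (d + 2 * i)) *\<^sub>R
         (\<integral>x. indicator (cball 0 1) x *\<^sub>R (norm x ^ (2 * i) *\<^sub>R q x) \<partial>lborel)
       = real DIM('a) *\<^sub>R (\<integral>x. indicator (cball 0 1) x *\<^sub>R (norm (sgn x :: 'a) ^ (2 * i) *\<^sub>R q (sgn x)) \<partial>lborel)"
  proof (rule integral_cball_homogeneous)
    show "continuous_on UNIV (\<lambda>x. norm x ^ (2 * i) *\<^sub>R q x)"
      using cont by (intro continuous_intros)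
    fix c :: real and x :: 'a
    have "\<bar>c\<bar> ^ (2 * i) = c ^ (2 * i)" by (simp add: power_mult)
    then show "norm (c *\<^sub>R x) ^ (2 * i) *\<^sub>R q (c *\<^sub>R x) = c ^ (d + 2 * i) *\<^sub>R (norm x ^ (2 * i) *\<^sub>R q x)"
      by (simp add: hom power_mult_distrib power_add mult_ac)
  qed
  also have "(\<integral>x. indicator (cball 0 1) x *\<^sub>R (norm (sgn x :: 'a) ^ (2 * i) *\<^sub>R q (sgn x)) \<partial>lborel)
      = (\<integral>x. indicator (cball 0 1) x *\<^sub>R q (sgn x :: 'a) \<partial>lborel)"
  proof (rule integral_cong_AE)
    show "AE x in lborel. indicator (cball 0 1) x *\<^sub>R (norm (sgn x :: 'a) ^ (2 * i) *\<^sub>R q (sgn x))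
        = indicator (cball 0 1) x *\<^sub>R q (sgn x :: 'a)"
      using AE_lborel_singleton[of 0] by eventually_elim (simp add: norm_sgn)
  qed (auto intro!: borel_measurable_scaleR borel_measurable_times borel_measurable_indicator)
  also have "\<dots> = measure lborel (cball 0 1 :: 'a set) *\<^sub>R (\<integral>x. q x \<partial>sphere_borel)"
    by (rule integral_sphere_borel) simp
  finally have *: "real (DIM('a) + (d + 2 * i)) *\<^sub>R
         (\<integral>x. indicator (cball 0 1) x *\<^sub>R (norm x ^ (2 * i) *\<^sub>R q x) \<partial>lborel)
       = real DIM('a) *\<^sub>R (measure lborel (cball 0 1 :: 'a set) *\<^sub>R (\<integral>x. q x \<partial>sphere_borel))" .
  have "(\<integral>x. indicator (cball 0 1) x *\<^sub>R (norm x ^ (2 * i) *\<^sub>R q x) \<partial>lborel)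
      = (1 / real (DIM('a) + (d + 2 * i))) *\<^sub>R (real (DIM('a) + (d + 2 * i)) *\<^sub>R
         (\<integral>x. indicator (cball 0 1) x *\<^sub>R (norm x ^ (2 * i) *\<^sub>R q x) \<partial>lborel))"
    using DIM_positive[where 'a='a] by (simp del: of_nat_add)
  then show ?thesis
    unfolding * by (simp add: add.assoc)
qed

text \<open>
  The divergence of the field \<open>u\<^sup>2 (F \<nabla>g - g \<nabla>F)\<close> integrates to zero, where \<open>u\<close> is
  \<open>1 - (norm x)\<^sup>2\<close> inside the ball and \<open>0\<close> outside. The square makes the field continuously
  differentiable across the sphere, so that no boundary term appears. Differentiating \<open>u\<^sup>2\<close>
  brings in radial derivatives, which Euler's relation turns into degrees.
\<close>

lemma green_identity_ball:
  fixes F g :: "'a::euclidean_space \<Rightarrow> complex"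
  assumes dF: "\<And>b x. b \<in> Basis \<Longrightarrow> ((\<lambda>t. F (x + t *\<^sub>R b)) has_vector_derivative F1 b x) (at 0)"
    and dF1: "\<And>b x. b \<in> Basis \<Longrightarrow> ((\<lambda>t. F1 b (x + t *\<^sub>R b)) has_vector_derivative F2 b x) (at 0)"
    and dg: "\<And>b x. b \<in> Basis \<Longrightarrow> ((\<lambda>t. g (x + t *\<^sub>R b)) has_vector_derivative g1 b x) (at 0)"
    and dg1: "\<And>b x. b \<in> Basis \<Longrightarrow> ((\<lambda>t. g1 b (x + t *\<^sub>R b)) has_vector_derivative g2 b x) (at 0)"
    and cF: "continuous_on UNIV F" "\<And>b. b \<in> Basis \<Longrightarrow> continuous_on UNIV (F1 b)"
      "\<And>b. b \<in> Basis \<Longrightarrow> continuous_on UNIV (F2 b)"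
    and cg: "continuous_on UNIV g" "\<And>b. b \<in> Basis \<Longrightarrow> continuous_on UNIV (g1 b)"
      "\<And>b. b \<in> Basis \<Longrightarrow> continuous_on UNIV (g2 b)"
    and eF: "\<And>x. (\<Sum>b\<in>Basis. (x \<bullet> b) *\<^sub>R F1 b x) = of_nat a * F x"
    and eg: "\<And>x. (\<Sum>b\<in>Basis. (x \<bullet> b) *\<^sub>R g1 b x) = of_nat e * g x"
    and D: "\<And>x. D x = F x * (\<Sum>b\<in>Basis. g2 b x) - g x * (\<Sum>b\<in>Basis. F2 b x)"
  shows "(\<integral>x. indicator (cball 0 1) x *\<^sub>R ((1 - (norm x)\<^sup>2)\<^sup>2 *\<^sub>R D x) \<partial>lborel)
       = 4 * (of_nat e - of_nat a) * (\<integral>x. indicator (cball 0 1) x *\<^sub>R ((1 - (norm x)\<^sup>2) *\<^sub>R (F x * g x)) \<partial>lborel)"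
proof -
  let ?u = "\<lambda>x::'a. max 0 (1 - (norm x)\<^sup>2)"
  define G where "G = (\<lambda>b x. (?u x)\<^sup>2 *\<^sub>R (F x * g1 b x - g x * F1 b x))"
  \<comment> \<open>In the derivative of \<open>G b\<close> the products of first derivatives cancel.\<close>
  define G' where "G' = (\<lambda>b x. (?u x)\<^sup>2 *\<^sub>R (F x * g2 b x - g x * F2 b x)
      + (- 4 * ?u x * (x \<bullet> b)) *\<^sub>R (F x * g1 b x - g x * F1 b x))"
  have uB: "?u x = indicator (cball 0 1) x * (1 - (norm x)\<^sup>2)" for x
    using abs_square_le_1[of "norm x"] abs_square_less_1[of "norm x"]
    by (auto split: split_indicator simp: max_def)
  have u0: "?u x = 0" if "norm x > 1" for x using that uB[of x] by simp
  have cu: "continuous_on UNIV ?u" by (intro continuous_intros)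
  have cG': "continuous_on UNIV (G' b)" if "b \<in> Basis" for b
    unfolding G'_def using that cF cg cu by (intro continuous_intros) auto
  have int0: "(\<integral>x. G' b x \<partial>lborel) = 0" if b: "b \<in> Basis" for b
  proof (rule integral_directional_derivative_eq_0[where G="G b" and b=b and R=1])
    fix x :: 'a
    have "((\<lambda>t. 1 - (norm (x + t *\<^sub>R b))\<^sup>2) has_real_derivative - 2 * (x \<bullet> b)) (at 0)"
    proof -
      have "1 - (norm (x + t *\<^sub>R b))\<^sup>2 = 1 - (x \<bullet> x + 2 * t * (x \<bullet> b) + t\<^sup>2 * (b \<bullet> b))" for t
        unfolding power2_norm_eq_inner by (simp add: inner_simps inner_commute algebra_simps power2_eq_square)
      moreover have "((\<lambda>t. 1 - (x \<bullet> x + 2 * t * (x \<bullet> b) + t\<^sup>2 * (b \<bullet> b))) has_real_derivative - 2 * (x \<bullet> b)) (at 0)"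
        by (auto intro!: derivative_eq_intros)
      ultimately show ?thesis by presburger
    qed
    from DERIV_chain2[OF has_field_derivative_max_0_power2 this]
    have du: "((\<lambda>t. (?u (x + t *\<^sub>R b))\<^sup>2) has_real_derivative - 4 * ?u x * (x \<bullet> b)) (at 0)"
      by (simp add: mult_ac)
    have "((\<lambda>t. F (x + t *\<^sub>R b) * g1 b (x + t *\<^sub>R b) - g (x + t *\<^sub>R b) * F1 b (x + t *\<^sub>R b))
        has_vector_derivative F x * g2 b x - g x * F2 b x) (at 0)"
      using has_vector_derivative_diff[OF has_vector_derivative_mult[OF dF[OF b, of x] dg1[OF b, of x]]
          has_vector_derivative_mult[OF dg[OF b, of x] dF1[OF b, of x]]]
      by (simp add: algebra_simps)
    from has_vector_derivative_scaleR[OF du this]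
    show "((\<lambda>t. G b (x + t *\<^sub>R b)) has_vector_derivative G' b x) (at 0)"
      by (simp add: G_def G'_def)
  next
    show "continuous_on UNIV (G b)"
      unfolding G_def using b cF cg cu by (intro continuous_intros) auto
  qed (use cG'[OF b] u0 in \<open>auto simp: G_def G'_def\<close>)
  have iG': "integrable lborel (G' b)" if "b \<in> Basis" for b
  proof -
    have "indicator (cball 0 1) x *\<^sub>R G' b x = G' b x" for x
      using u0[of x] by (auto split: split_indicator simp: G'_def)
    then show ?thesis using integrable_cball_continuous[OF cG'[OF that]] by simp
  qed
  have sumG': "(\<Sum>b\<in>Basis. G' b x) = indicator (cball 0 1) x *\<^sub>R ((1 - (norm x)\<^sup>2)\<^sup>2 *\<^sub>R D x)
     - 4 * (of_nat e - of_nat a) * (indicator (cball 0 1) x *\<^sub>R ((1 - (norm x)\<^sup>2) *\<^sub>R (F x * g x)))" for x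
  proof -
    have "(\<Sum>b\<in>Basis. G' b x) = (?u x)\<^sup>2 *\<^sub>R D x
       - (4 * ?u x) *\<^sub>R (F x * (\<Sum>b\<in>Basis. (x \<bullet> b) *\<^sub>R g1 b x) - g x * (\<Sum>b\<in>Basis. (x \<bullet> b) *\<^sub>R F1 b x))"
      unfolding G'_def D
      by (simp add: sum.distrib sum_subtractf sum_distrib_left scaleR_sum_right algebra_simps sum_negf)
    also have "\<dots> = (?u x)\<^sup>2 *\<^sub>R D x - 4 * (of_nat e - of_nat a) * (?u x *\<^sub>R (F x * g x))"
      unfolding eF eg by (simp add: algebra_simps scaleR_conv_of_real)
    finally show ?thesis unfolding uB by (simp add: power2_eq_square split: split_indicator)
  qed
  have cD: "continuous_on UNIV D"
    unfolding D using cF cg by (intro continuous_intros) auto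
  have i1: "integrable lborel (\<lambda>x. indicator (cball 0 1) x *\<^sub>R ((1 - (norm x)\<^sup>2)\<^sup>2 *\<^sub>R D x))"
    using cD by (intro integrable_cball_continuous continuous_intros)
  have i2: "integrable lborel (\<lambda>x. indicator (cball 0 1) x *\<^sub>R ((1 - (norm x)\<^sup>2) *\<^sub>R (F x * g x)))"
    using cF cg by (intro integrable_cball_continuous continuous_intros)
  have "0 = (\<Sum>b\<in>Basis. \<integral>x. G' b x \<partial>lborel)" by (simp add: int0)
  also have "\<dots> = (\<integral>x. (\<Sum>b\<in>Basis. G' b x) \<partial>lborel)"
    by (rule Bochner_Integration.integral_sum[symmetric]) (rule iG')
  also have "\<dots> = (\<integral>x. indicator (cball 0 1) x *\<^sub>R ((1 - (norm x)\<^sup>2)\<^sup>2 *\<^sub>R D x) \<partial>lborel)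
       - 4 * (of_nat e - of_nat a) * (\<integral>x. indicator (cball 0 1) x *\<^sub>R ((1 - (norm x)\<^sup>2) *\<^sub>R (F x * g x)) \<partial>lborel)"
    unfolding sumG' using i1 i2
    by (simp only: Bochner_Integration.integral_diff Bochner_Integration.integral_mult_right_zero
          Bochner_Integration.integrable_mult_right)
  finally show ?thesis by simp
qed

text \<open>
  For homogeneous integrands both sides of the identity on the ball are explicit multiples of
  integrals over the sphere. The alternative in the last assumption covers the case \<open>a + e < 2\<close>,
  in which no natural number \<open>d\<close> satisfies the equation, but \<open>D\<close> vanishes.
\<close>

lemma green_identity_sphere:
  fixes F g D :: "'a::euclidean_space \<Rightarrow> complex"
  assumes cF: "continuous_on UNIV F" and cg: "continuous_on UNIV g" and cD: "continuous_on UNIV D"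
    and hF: "\<And>c x. F (c *\<^sub>R x) = c ^ a *\<^sub>R F x"
    and hg: "\<And>c x. g (c *\<^sub>R x) = c ^ e *\<^sub>R g x"
    and hD: "\<And>c x. D (c *\<^sub>R x) = c ^ d *\<^sub>R D x"
    and ball: "(\<integral>x. indicator (cball 0 1) x *\<^sub>R ((1 - (norm x)\<^sup>2)\<^sup>2 *\<^sub>R D x) \<partial>lborel)
       = 4 * (of_nat e - of_nat a) * (\<integral>x. indicator (cball 0 1) x *\<^sub>R ((1 - (norm x)\<^sup>2) *\<^sub>R (F x * g x)) \<partial>lborel)"
    and deg: "d + 2 = a + e \<or> (\<forall>x. D x = 0)"
  shows "((real e - real a) * (real DIM('a) + real a + real e - 2)) *\<^sub>R (\<integral>x. F x * g x \<partial>sphere_borel)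
       = (\<integral>x. D x \<partial>sphere_borel)"
proof -
  define N where "N = real DIM('a)"
  \<comment> \<open>The surface area of the unit sphere, so that the integral over the ball of a homogeneous function of degree \<open>r\<close> is \<open>c / (N + r)\<close> times its mean value over the sphere.\<close>
  define c where "c = N * measure lborel (cball 0 1 :: 'a set)"
  have N: "N \<ge> 1" unfolding N_def using DIM_positive[where 'a='a] by linarith
  have c: "c > 0" using N measure_unit_cball_pos[where 'a='a] by (simp add: c_def)
  define X where "X = (\<integral>x. F x * g x \<partial>sphere_borel)"
  define Z where "Z = (\<integral>x. D x \<partial>sphere_borel)"
  have mom: "(\<integral>x. indicator (cball 0 1) x *\<^sub>R (norm x ^ (2 * i) *\<^sub>R q x) \<partial>lborel)
      = (c / (N + r + 2 * i)) *\<^sub>R (\<integral>x. q x \<partial>sphere_borel)"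
    if "continuous_on UNIV q" "\<And>c x. q (c *\<^sub>R x) = c ^ r *\<^sub>R q x" for q :: "'a \<Rightarrow> complex" and r i
    using integral_cball_homogeneous_even_power[OF that] by (simp add: c_def N_def add_ac)
  have itg: "integrable lborel (\<lambda>x. indicator (cball 0 1) x *\<^sub>R (norm x ^ (2 * i) *\<^sub>R q x))"
    if "continuous_on UNIV q" for q :: "'a \<Rightarrow> complex" and i
    using that by (intro integrable_cball_continuous continuous_intros)
  let ?w = "\<lambda>q i x. indicator (cball 0 1) x *\<^sub>R (norm x ^ (2 * i) *\<^sub>R q x) :: complex"
  have cFg: "continuous_on UNIV (\<lambda>x. F x * g x)" using cF cg by (intro continuous_intros)
  have hFg: "F (c *\<^sub>R x) * g (c *\<^sub>R x) = c ^ (a + e) *\<^sub>R (F x * g x)" for c x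
    by (simp add: hF hg power_add)
  have "(\<integral>x. indicator (cball 0 1) x *\<^sub>R ((1 - (norm x)\<^sup>2)\<^sup>2 *\<^sub>R D x) \<partial>lborel)
      = (\<integral>x. ?w D 0 x - 2 *\<^sub>R ?w D 1 x + ?w D 2 x \<partial>lborel)"
    by (intro Bochner_Integration.integral_cong)
       (auto split: split_indicator simp: power2_eq_square power4_eq_xxxx algebra_simps scaleR_conv_of_real)
  also have "\<dots> = (\<integral>x. ?w D 0 x \<partial>lborel) - 2 *\<^sub>R (\<integral>x. ?w D 1 x \<partial>lborel) + (\<integral>x. ?w D 2 x \<partial>lborel)"
    using itg[OF cD, of 0] itg[OF cD, of 1] itg[OF cD, of 2]
    by (simp only: Bochner_Integration.integral_diff Bochner_Integration.integral_add
        integral_scaleR_right integrable_scaleR_right Bochner_Integration.integrable_diff)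
  also have "\<dots> = (c / (N + d) - 2 * (c / (N + d + 2)) + c / (N + d + 4)) *\<^sub>R Z"
    unfolding mom[OF cD hD] Z_def[symmetric] by (simp add: scaleR_add_left scaleR_diff_left)
  also have "c / (N + d) - 2 * (c / (N + d + 2)) + c / (N + d + 4)
      = 8 * c / ((N + d) * (N + d + 2) * (N + d + 4))"
  proof -
    have "N + d \<noteq> 0" "N + d + 2 \<noteq> 0" "N + d + 4 \<noteq> 0" using N by linarith+
    then show ?thesis by (simp add: divide_simps) algebra
  qed
  finally have L: "(\<integral>x. indicator (cball 0 1) x *\<^sub>R ((1 - (norm x)\<^sup>2)\<^sup>2 *\<^sub>R D x) \<partial>lborel)
      = (8 * c / ((N + d) * (N + d + 2) * (N + d + 4))) *\<^sub>R Z" .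
  have "(\<integral>x. indicator (cball 0 1) x *\<^sub>R ((1 - (norm x)\<^sup>2) *\<^sub>R (F x * g x)) \<partial>lborel)
      = (\<integral>x. ?w (\<lambda>x. F x * g x) 0 x - ?w (\<lambda>x. F x * g x) 1 x \<partial>lborel)"
    by (intro Bochner_Integration.integral_cong)
       (auto split: split_indicator simp: algebra_simps power2_eq_square)
  also have "\<dots> = (\<integral>x. ?w (\<lambda>x. F x * g x) 0 x \<partial>lborel) - (\<integral>x. ?w (\<lambda>x. F x * g x) 1 x \<partial>lborel)"
    by (rule Bochner_Integration.integral_diff) (rule itg[OF cFg])+
  also have "\<dots> = (c / (N + (a + e)) - c / (N + (a + e) + 2)) *\<^sub>R X"
    unfolding mom[OF cFg hFg] X_def[symmetric] by (simp add: scaleR_diff_left)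
  also have "c / (N + (a + e)) - c / (N + (a + e) + 2) = 2 * c / ((N + (a + e)) * (N + (a + e) + 2))"
  proof -
    have "N + (a + e) \<noteq> 0" "N + (a + e) + 2 \<noteq> 0" using N by linarith+
    then show ?thesis by (simp add: divide_simps) (simp add: algebra_simps)
  qed
  finally have R: "(\<integral>x. indicator (cball 0 1) x *\<^sub>R ((1 - (norm x)\<^sup>2) *\<^sub>R (F x * g x)) \<partial>lborel)
      = (2 * c / ((N + (a + e)) * (N + (a + e) + 2))) *\<^sub>R X" .
  have eq: "(8 * c / ((N + d) * (N + d + 2) * (N + d + 4))) *\<^sub>R Z
      = (8 * c * (real e - real a) / ((N + (a + e)) * (N + (a + e) + 2))) *\<^sub>R X"
    using ball unfolding L R by (simp add: scaleR_conv_of_real)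
  show ?thesis
  proof (cases "d + 2 = a + e")
    case True
    then have ae: "real (a + e) = d + 2" by linarith
    have nz: "N + d \<noteq> 0" "N + d + 2 \<noteq> 0" "N + d + 4 \<noteq> 0" using N by linarith+
    define k where "k = (N + d) * (N + d + 2) * (N + d + 4) / (8 * c)"
    have k1: "k * (8 * c / ((N + d) * (N + d + 2) * (N + d + 4))) = 1"
      using nz c by (simp add: k_def)
    have k2: "k * (8 * c * (real e - real a) / ((N + (a + e)) * (N + (a + e) + 2))) = (real e - real a) * (N + d)"
      using nz c unfolding ae k_def by (simp add: divide_simps) (simp add: algebra_simps)
    have "Z = (k * (8 * c / ((N + d) * (N + d + 2) * (N + d + 4)))) *\<^sub>R Z" unfolding k1 by simp
    also have "\<dots> = k *\<^sub>R ((8 * c / ((N + d) * (N + d + 2) * (N + d + 4))) *\<^sub>R Z)" by simp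
    also have "\<dots> = ((real e - real a) * (N + d)) *\<^sub>R X" unfolding eq scaleR_scaleR k2 ..
    finally have Z: "Z = ((real e - real a) * (N + d)) *\<^sub>R X" .
    have "real DIM('a) + real a + real e - 2 = N + d" using ae by (simp add: N_def)
    then show ?thesis using Z by (simp only: X_def Z_def)
  next
    case False
    then have D0: "D x = 0" for x using deg by auto
    then have "Z = 0" by (simp add: Z_def)
    have "N + (a + e) \<noteq> 0" "N + (a + e) + 2 \<noteq> 0" using N by linarith+
    with eq \<open>Z = 0\<close> c have "real e - real a = 0 \<or> X = 0" by auto
    then show ?thesis using D0 by (auto simp: X_def)
  qed
qed

section \<open>Harmonic polynomials and powers of the projected length\<close>

lemma real_polynomial_function_directional_derivative:
  fixes p :: "'a::euclidean_space \<Rightarrow> real"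
  assumes "real_polynomial_function p"
  shows "\<exists>q. real_polynomial_function q \<and> (\<forall>x. ((\<lambda>t. p (x + t *\<^sub>R b)) has_real_derivative q x) (at 0))"
  using assms
proof (induction p)
  case (linear h)
  interpret bounded_linear h by (rule linear)
  have "((\<lambda>t. h (x + t *\<^sub>R b)) has_real_derivative h b) (at 0)" for x
    unfolding add scaleR by (auto intro!: derivative_eq_intros)
  then show ?case by (intro exI[of _ "\<lambda>x. h b"]) auto
next
  case (const c)
  show ?case by (intro exI[of _ "\<lambda>x. 0"]) auto
next
  case (add f1 f2)
  then obtain q1 q2 where "real_polynomial_function q1" "real_polynomial_function q2"
    "\<And>x. ((\<lambda>t. f1 (x + t *\<^sub>R b)) has_real_derivative q1 x) (at 0)"
    "\<And>x. ((\<lambda>t. f2 (x + t *\<^sub>R b)) has_real_derivative q2 x) (at 0)" by blast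
  then show ?case by (intro exI[of _ "\<lambda>x. q1 x + q2 x"]) (auto intro!: derivative_eq_intros)
next
  case (mult f1 f2)
  then obtain q1 q2 where "real_polynomial_function q1" "real_polynomial_function q2"
    "\<And>x. ((\<lambda>t. f1 (x + t *\<^sub>R b)) has_real_derivative q1 x) (at 0)"
    "\<And>x. ((\<lambda>t. f2 (x + t *\<^sub>R b)) has_real_derivative q2 x) (at 0)" by blast
  then show ?case using mult.hyps
    by (intro exI[of _ "\<lambda>x. f1 x * q2 x + f2 x * q1 x"]) (auto intro!: derivative_eq_intros)
qed

lemma complex_polynomial_function_iff:
  fixes p :: "'a::euclidean_space \<Rightarrow> complex"
  shows "polynomial_function p \<longleftrightarrow>
    real_polynomial_function (\<lambda>x. Re (p x)) \<and> real_polynomial_function (\<lambda>x. Im (p x))"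
  by (subst polynomial_function_iff_Basis_inner) (auto simp: Basis_complex_def inner_complex_def real_polynomial_function_eq)

lemma polynomial_function_dir_deriv:
  fixes p :: "'a::euclidean_space \<Rightarrow> complex"
  assumes "polynomial_function p"
  shows "polynomial_function (dir_deriv b p)"
    and "((\<lambda>t. p (x + t *\<^sub>R b)) has_vector_derivative dir_deriv b p x) (at 0)"
proof -
  obtain q1 q2 where q: "real_polynomial_function q1" "real_polynomial_function q2"
    "\<And>x. ((\<lambda>t. Re (p (x + t *\<^sub>R b))) has_real_derivative q1 x) (at 0)"
    "\<And>x. ((\<lambda>t. Im (p (x + t *\<^sub>R b))) has_real_derivative q2 x) (at 0)"
    using assms unfolding complex_polynomial_function_iff
    using real_polynomial_function_directional_derivative[of "\<lambda>x. Re (p x)" b]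
      real_polynomial_function_directional_derivative[of "\<lambda>x. Im (p x)" b] by blast
  have d: "((\<lambda>t. p (x + t *\<^sub>R b)) has_vector_derivative Complex (q1 x) (q2 x)) (at 0)" for x
    unfolding has_vector_derivative_complex_iff using q(3,4)[of x] by simp
  have "dir_deriv b p = (\<lambda>x. Complex (q1 x) (q2 x))"
    unfolding dir_deriv_def using vector_derivative_at[OF d] by (intro ext)
  then show "polynomial_function (dir_deriv b p)"
    "((\<lambda>t. p (x + t *\<^sub>R b)) has_vector_derivative dir_deriv b p x) (at 0)"
    using q(1,2) d by (auto simp: complex_polynomial_function_iff)
qed

lemma laplacian_const: "laplacian (\<lambda>x. c) x = 0"
  by (simp add: laplacian_def dir_deriv_def)

text \<open>
  Both sides are the derivative at \<open>x\<close> in the direction \<open>x\<close> itself: on the left expanded in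
  the basis, on the right computed from \<open>p ((1 + t) *\<^sub>R x) = (1 + t) ^ d *\<^sub>R p x\<close>.
\<close>

lemma euler_homogeneous:
  fixes p :: "'a::euclidean_space \<Rightarrow> complex"
  assumes p: "polynomial_function p" and hom: "\<And>c x. p (c *\<^sub>R x) = c ^ d *\<^sub>R p x"
  shows "(\<Sum>b\<in>Basis. (x \<bullet> b) *\<^sub>R dir_deriv b p x) = of_nat d * p x"
proof -
  obtain D where D: "(p has_derivative D) (at x)"
    using differentiable_at_polynomial_function[OF p, of x UNIV] unfolding differentiable_def by auto
  interpret D: bounded_linear D using D by (rule has_derivative_bounded_linear)
  have line: "((\<lambda>t. p (x + t *\<^sub>R y)) has_vector_derivative D y) (at 0)" for y
  proof -
    have "((\<lambda>t. x + t *\<^sub>R y) has_derivative (\<lambda>t. t *\<^sub>R y)) (at 0)"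
      by (auto intro!: derivative_eq_intros)
    from has_derivative_compose[OF this, of p D] D
    show ?thesis by (simp add: has_vector_derivative_def D.scaleR)
  qed
  have "dir_deriv b p x = D b" for b
    unfolding dir_deriv_def by (rule vector_derivative_at[OF line])
  then have "(\<Sum>b\<in>Basis. (x \<bullet> b) *\<^sub>R dir_deriv b p x) = D (\<Sum>b\<in>Basis. (x \<bullet> b) *\<^sub>R b)"
    by (simp add: D.sum D.scaleR)
  also have "\<dots> = D x" by (simp add: euclidean_representation)
  also have "D x = of_nat d * p x"
  proof -
    have "((\<lambda>t. (1 + t) ^ d *\<^sub>R p x) has_vector_derivative (of_nat d * p x)) (at 0)"
    proof -
      have "((\<lambda>t. (1 + t) ^ d) has_real_derivative real d) (at 0)"
        by (auto intro!: derivative_eq_intros)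
      from has_vector_derivative_scaleR[OF this has_vector_derivative_const[of "p x"]]
      show ?thesis by (simp add: scaleR_conv_of_real)
    qed
    moreover have "(\<lambda>t. p (x + t *\<^sub>R x)) = (\<lambda>t. (1 + t) ^ d *\<^sub>R p x)"
      using hom[of "1 + t" x for t] by (simp add: scaleR_add_left)
    ultimately show ?thesis using line[of x] vector_derivative_unique_at by metis
  qed
  finally show ?thesis .
qed

lemma stiefel_sum_columns:
  fixes v :: "real ^ 'm ^ 'n"
  assumes "v \<in> stiefel"
  shows "(\<Sum>l\<in>UNIV. v $ l $ i * v $ l $ i') = (if i = i' then 1 else 0)"
  using assms by (auto simp: stiefel_def vec_eq_iff matrix_matrix_mult_def transpose_def mat_def)

lemma vector_matrix_mult_axis: "axis l 1 v* (v :: real ^ 'm ^ 'n) = v $ l"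
  by (simp add: vec_eq_iff vector_matrix_mult_def axis_def if_distrib if_distribR cong: if_cong)

definition proj_sq :: "real ^ 'm ^ 'n \<Rightarrow> real ^ 'n \<Rightarrow> real" where
  "proj_sq v x = (x v* v) \<bullet> (x v* v)"

lemma vector_matrix_mult_line:
  fixes v :: "real ^ 'm ^ 'n"
  shows "(x + t *\<^sub>R b) v* v = x v* v + t *\<^sub>R (b v* v)"
  by (simp add: vec_eq_iff vector_matrix_mult_def sum.distrib sum_distrib_left algebra_simps)

lemma proj_sq_scaleR: "proj_sq v (c *\<^sub>R x) = c\<^sup>2 * proj_sq v x"
  using vector_matrix_mult_line[of 0 c x v] by (simp add: proj_sq_def power2_eq_square)

lemma proj_sq_eq_norm: "proj_sq v x = (norm (x v* v))\<^sup>2"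
  by (simp add: proj_sq_def power2_norm_eq_inner)

text \<open>
  With \<open>y = x v* v\<close>, orthonormality of the columns gives \<open>norm (v *v y) = norm y\<close>, while
  \<open>(norm y)\<^sup>2 = x \<bullet> (v *v y)\<close>; the Cauchy--Schwarz inequality concludes.
\<close>

lemma norm_vector_matrix_stiefel_le:
  fixes v :: "real ^ 'm ^ 'n"
  assumes "v \<in> stiefel"
  shows "norm (x v* v) \<le> norm x"
proof -
  let ?y = "x v* v"
  have "(v *v ?y) v* v = transpose v *v (v *v ?y)" by simp
  also have "\<dots> = (transpose v ** v) *v ?y" by (rule matrix_vector_mul_assoc)
  also have "\<dots> = ?y" using assms by (simp add: stiefel_def)
  finally have n: "(norm (v *v ?y))\<^sup>2 = (norm ?y)\<^sup>2"
    unfolding power2_norm_eq_inner by (metis dot_lmul_matrix)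
  have "(norm ?y)\<^sup>2 = x \<bullet> (v *v ?y)"
    by (simp add: power2_norm_eq_inner dot_lmul_matrix)
  also have "\<dots> \<le> norm x * norm (v *v ?y)" by (rule norm_cauchy_schwarz)
  also have "norm (v *v ?y) = norm ?y" using n by simp
  finally show ?thesis by (cases "norm ?y = 0") (auto simp: power2_eq_square)
qed

lemma polynomial_function_proj_sq_power: "polynomial_function (\<lambda>x. complex_of_real (proj_sq v x ^ s))"
proof -
  have "real_polynomial_function (\<lambda>x. (x v* v) $ i)" for i
    by (rule real_polynomial_function.intros(1))
       (auto simp: vector_matrix_mult_def intro!: bounded_linear_sum bounded_linear_vec_nth bounded_linear_mult_const)
  then show ?thesis
    by (auto simp: complex_polynomial_function_iff proj_sq_def inner_vec_def
        intro!: real_polynomial_function_power real_polynomial_function_sum real_polynomial_function.intros(2-4))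
qed

lemma continuous_on_norm_vector_matrix: "continuous_on S (\<lambda>x. norm (x v* (v :: real ^ 'm ^ 'n)))"
proof -
  have "norm (x v* v) = sqrt (Re (complex_of_real (proj_sq v x ^ 1)))" for x
    by (simp add: proj_sq_eq_norm)
  then show ?thesis
    using continuous_on_polymonial_function[OF polynomial_function_proj_sq_power[of v 1], of S]
    by (simp only: continuous_on_real_sqrt continuous_on_Re)
qed

text \<open>
  The gradient of \<open>proj_sq v\<close> at \<open>x\<close> has the components \<open>2 * ((b v* v) \<bullet> (x v* v))\<close>. These
  two sums are therefore what enters the Laplacian of its powers: the squared length of the
  gradient and the trace of the Hessian, up to constants.
\<close>

lemma sum_inner_rows_sq:
  fixes v :: "real ^ 'm ^ 'n"
  assumes "v \<in> stiefel"
  shows "(\<Sum>b\<in>Basis. ((b v* v) \<bullet> y)\<^sup>2) = y \<bullet> y" and "(\<Sum>b\<in>Basis. proj_sq v b) = real CARD('m)"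
proof -
  have B: "(\<Sum>b\<in>Basis. h b) = (\<Sum>l\<in>UNIV. h (axis l 1))" for h :: "real ^ 'n \<Rightarrow> real"
  proof -
    have 1: "(Basis :: (real ^ 'n) set) = range (\<lambda>l. axis l 1)" by (auto simp: Basis_vec_def)
    have 2: "inj (\<lambda>l :: 'n. axis l (1 :: real))" by (auto simp: inj_on_def axis_eq_axis)
    show ?thesis unfolding 1 sum.reindex[OF 2] by simp
  qed
  have "(\<Sum>b\<in>Basis. ((b v* v) \<bullet> y)\<^sup>2) = (\<Sum>l\<in>UNIV. (v $ l \<bullet> y)\<^sup>2)"
    unfolding B vector_matrix_mult_axis ..
  also have "\<dots> = (\<Sum>l\<in>UNIV. \<Sum>i\<in>UNIV. \<Sum>i'\<in>UNIV. (v $ l $ i * v $ l $ i') * (y $ i * y $ i'))"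
    by (simp add: inner_vec_def power2_eq_square sum_product mult_ac)
  also have "\<dots> = (\<Sum>i\<in>UNIV. \<Sum>i'\<in>UNIV. \<Sum>l\<in>UNIV. (v $ l $ i * v $ l $ i') * (y $ i * y $ i'))"
    by (subst sum.swap, intro sum.cong refl, subst sum.swap, rule refl)
  also have "\<dots> = y \<bullet> y"
    by (simp add: sum_distrib_right[symmetric] stiefel_sum_columns[OF assms] inner_vec_def
        if_distrib if_distribR cong: if_cong)
  finally show "(\<Sum>b\<in>Basis. ((b v* v) \<bullet> y)\<^sup>2) = y \<bullet> y" .
  have "(\<Sum>b\<in>Basis. proj_sq v b) = (\<Sum>l\<in>UNIV. \<Sum>i\<in>UNIV. v $ l $ i * v $ l $ i)"
    unfolding B proj_sq_def vector_matrix_mult_axis by (simp add: inner_vec_def)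
  also have "\<dots> = (\<Sum>i\<in>UNIV. \<Sum>l\<in>UNIV. v $ l $ i * v $ l $ i)" by (rule sum.swap)
  also have "\<dots> = real CARD('m)" by (simp add: stiefel_sum_columns[OF assms])
  finally show "(\<Sum>b\<in>Basis. proj_sq v b) = real CARD('m)" .
qed

lemma proj_sq_line:
  "proj_sq v (x + t *\<^sub>R b) = proj_sq v x + 2 * t * ((b v* v) \<bullet> (x v* v)) + t\<^sup>2 * proj_sq v b"
  unfolding proj_sq_def vector_matrix_mult_line by (simp add: inner_simps inner_commute power2_eq_square algebra_simps)

lemma dir_deriv_proj_sq_power:
  "dir_deriv b (\<lambda>x. complex_of_real (proj_sq v x ^ s)) x
     = of_real (2 * real s * proj_sq v x ^ (s - 1) * ((b v* v) \<bullet> (x v* v)))"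
  unfolding dir_deriv_def
proof (rule vector_derivative_at)
  have "((\<lambda>t. (proj_sq v x + 2 * t * ((b v* v) \<bullet> (x v* v)) + t\<^sup>2 * proj_sq v b) ^ s)
    has_real_derivative 2 * real s * proj_sq v x ^ (s - 1) * ((b v* v) \<bullet> (x v* v))) (at 0)"
    by (auto intro!: derivative_eq_intros simp: mult_ac)
  then show "((\<lambda>t. complex_of_real (proj_sq v (x + t *\<^sub>R b) ^ s)) has_vector_derivative
    of_real (2 * real s * proj_sq v x ^ (s - 1) * ((b v* v) \<bullet> (x v* v)))) (at 0)"
    unfolding proj_sq_line by (rule has_vector_derivative_of_real)
qed

lemma laplacian_proj_sq_power:
  fixes v :: "real ^ 'm ^ 'n"
  assumes "v \<in> stiefel"
  shows "laplacian (\<lambda>x. complex_of_real (proj_sq v x ^ s)) x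
     = of_real (2 * real s * (2 * real s + real CARD('m) - 2) * proj_sq v x ^ (s - 1))"
proof -
  let ?c = "\<lambda>b x. (b v* v) \<bullet> (x v* v)"
  have 2: "dir_deriv b (dir_deriv b (\<lambda>x. complex_of_real (proj_sq v x ^ s))) x
     = of_real (4 * real s * real (s - 1) * proj_sq v x ^ (s - 2) * (?c b x)\<^sup>2 + 2 * real s * proj_sq v x ^ (s - 1) * proj_sq v b)" for b
    unfolding dir_deriv_proj_sq_power[abs_def] dir_deriv_def
  proof (rule vector_derivative_at)
    have c: "?c b (x + t *\<^sub>R b) = ?c b x + t * proj_sq v b" for t
      unfolding proj_sq_def vector_matrix_mult_line by (simp add: inner_simps)
    have "((\<lambda>t. 2 * real s * (proj_sq v x + 2 * t * ?c b x + t\<^sup>2 * proj_sq v b) ^ (s - 1) * (?c b x + t * proj_sq v b))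
      has_real_derivative 4 * real s * real (s - 1) * proj_sq v x ^ (s - 2) * (?c b x)\<^sup>2
        + 2 * real s * proj_sq v x ^ (s - 1) * proj_sq v b) (at 0)"
      by (auto intro!: derivative_eq_intros simp: algebra_simps power2_eq_square numeral_2_eq_2)
    then show "((\<lambda>t. complex_of_real (2 * real s * proj_sq v (x + t *\<^sub>R b) ^ (s - 1) * ?c b (x + t *\<^sub>R b))) has_vector_derivative
      of_real (4 * real s * real (s - 1) * proj_sq v x ^ (s - 2) * (?c b x)\<^sup>2
        + 2 * real s * proj_sq v x ^ (s - 1) * proj_sq v b)) (at 0)"
      unfolding proj_sq_line c by (rule has_vector_derivative_of_real)
  qed
  have "laplacian (\<lambda>x. complex_of_real (proj_sq v x ^ s)) x
      = of_real (4 * real s * real (s - 1) * proj_sq v x ^ (s - 2) * (\<Sum>b\<in>Basis. (?c b x)\<^sup>2)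
          + 2 * real s * proj_sq v x ^ (s - 1) * (\<Sum>b\<in>Basis. proj_sq v b))"
    unfolding laplacian_def 2 of_real_sum[symmetric] sum.distrib sum_distrib_left[symmetric] ..
  also have "(\<Sum>b\<in>Basis. (?c b x)\<^sup>2) = proj_sq v x"
    unfolding sum_inner_rows_sq(1)[OF assms] proj_sq_def ..
  also have "4 * real s * real (s - 1) * proj_sq v x ^ (s - 2) * proj_sq v x
      + 2 * real s * proj_sq v x ^ (s - 1) * (\<Sum>b\<in>Basis. proj_sq v b)
      = 2 * real s * (2 * real s + real CARD('m) - 2) * proj_sq v x ^ (s - 1)"
  proof -
    consider "s = 0" | "s = 1" | r where "s = Suc (Suc r)" by (metis One_nat_def not0_implies_Suc)
    then show ?thesis
      by cases (simp_all add: sum_inner_rows_sq(2)[OF assms] algebra_simps)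
  qed
  finally show ?thesis .
qed

text \<open>
  The even moments, with respect to the projected length, of the complex measure with
  density \<open>p\<close> on the sphere.
\<close>

definition sphere_moment :: "real ^ 'm ^ 'n \<Rightarrow> (real ^ 'n \<Rightarrow> complex) \<Rightarrow> nat \<Rightarrow> complex" where
  "sphere_moment v p s = (\<integral>x. of_real (proj_sq v x ^ s) * p x \<partial>sphere_borel)"

text \<open>
  Green's identity for \<open>F = proj_sq v ^ s\<close>, homogeneous of degree \<open>2 * s\<close>, and the harmonic
  \<open>p\<close>: the term with the Laplacian of \<open>p\<close> drops out, and the Laplacian of \<open>F\<close> is a multiple of
  \<open>proj_sq v ^ (s - 1)\<close>. At \<open>s = 0\<close> the truncated subtraction is harmless because of the
  factor \<open>s\<close> on the right.
\<close>

lemma sphere_moment_recurrence: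
  fixes v :: "real ^ 'm ^ 'n" and p :: "real ^ 'n \<Rightarrow> complex"
  assumes v: "v \<in> stiefel" and p: "polynomial_function p"
    and hom: "\<And>c x. p (c *\<^sub>R x) = c ^ j *\<^sub>R p x" and harm: "\<And>x. laplacian p x = 0"
  shows "((2 * real s - real j) * (2 * real s + real j + real CARD('n) - 2)) *\<^sub>R sphere_moment v p s
       = (2 * real s * (2 * real s + real CARD('m) - 2)) *\<^sub>R sphere_moment v p (s - 1)"
proof -
  let ?F = "\<lambda>s x. complex_of_real (proj_sq v x ^ s)"
  have pF: "polynomial_function (?F s)" for s by (rule polynomial_function_proj_sq_power)
  have hF: "?F s (c *\<^sub>R x) = c ^ (2 * s) *\<^sub>R ?F s x" for s c x
    by (simp add: proj_sq_scaleR power_mult_distrib power_mult scaleR_conv_of_real[of _ "_ :: complex"])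
  define \<kappa> where "\<kappa> = 2 * real s * (2 * real s + real CARD('m) - 2)"
  define D where "D = (\<lambda>x. - of_real \<kappa> * (?F (s - 1) x * p x))"
  have pp: "polynomial_function (dir_deriv b (dir_deriv b q))" "polynomial_function (dir_deriv b q)"
    if "polynomial_function q" for q :: "real ^ 'n \<Rightarrow> complex" and b
    using that by (auto intro: polynomial_function_dir_deriv(1))
  have D: "D x = ?F s x * (\<Sum>b\<in>Basis. dir_deriv b (dir_deriv b p) x)
      - p x * (\<Sum>b\<in>Basis. dir_deriv b (dir_deriv b (?F s)) x)" for x
    using harm[of x] laplacian_proj_sq_power[OF v, of s x] by (simp add: laplacian_def D_def \<kappa>_def)
  have "polynomial_function D"
  proof -
    have "polynomial_function (\<lambda>x. ?F (s - 1) x * p x)"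
      using pF[of "s - 1"] p unfolding complex_polynomial_function_iff by (auto intro!: real_polynomial_function.intros(2-4) real_polynomial_function_diff)
    then have "polynomial_function (\<lambda>x. (- \<kappa>) *\<^sub>R (?F (s - 1) x * p x))"
      by (rule polynomial_function_cmul)
    then show ?thesis by (simp add: D_def scaleR_conv_of_real)
  qed
  note cont = continuous_on_polymonial_function
  have "((real j - real (2 * s)) * (real DIM(real ^ 'n) + real (2 * s) + real j - 2)) *\<^sub>R (\<integral>x. ?F s x * p x \<partial>sphere_borel)
       = (\<integral>x. D x \<partial>sphere_borel)"
  proof (rule green_identity_sphere[where d = "2 * (s - 1) + j"])
    show "D (c *\<^sub>R x) = c ^ (2 * (s - 1) + j) *\<^sub>R D x" for c x
      unfolding D_def hF hom by (simp add: power_add scaleR_conv_of_real[of _ "_ :: complex"])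
    show "2 * (s - 1) + j + 2 = 2 * s + j \<or> (\<forall>x. D x = 0)"
      by (cases s) (auto simp: D_def \<kappa>_def)
    show "(\<integral>x. indicator (cball 0 1) x *\<^sub>R ((1 - (norm x)\<^sup>2)\<^sup>2 *\<^sub>R D x) \<partial>lborel)
       = 4 * (of_nat j - of_nat (2 * s)) * (\<integral>x. indicator (cball 0 1) x *\<^sub>R ((1 - (norm x)\<^sup>2) *\<^sub>R (?F s x * p x)) \<partial>lborel)"
      by (rule green_identity_ball[OF polynomial_function_dir_deriv(2)[OF pF]
            polynomial_function_dir_deriv(2)[OF pp(2)[OF pF]]
            polynomial_function_dir_deriv(2)[OF p] polynomial_function_dir_deriv(2)[OF pp(2)[OF p]]
            cont[OF pF] cont[OF pp(2)[OF pF]] cont[OF pp(1)[OF pF]]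
            cont[OF p] cont[OF pp(2)[OF p]] cont[OF pp(1)[OF p]]
            euler_homogeneous[OF pF hF] euler_homogeneous[OF p hom] D])
  qed (rule cont pF p hF hom \<open>polynomial_function D\<close>)+
  also have "(\<integral>x. D x \<partial>sphere_borel) = - of_real \<kappa> * (\<integral>x. ?F (s - 1) x * p x \<partial>sphere_borel)"
    unfolding D_def by (rule Bochner_Integration.integral_mult_right_zero)
  finally show ?thesis
    unfolding sphere_moment_def \<kappa>_def[symmetric] by (simp add: scaleR_conv_of_real algebra_simps)
qed

section \<open>Moments and norm of the Jacobi polynomials\<close>

lemma pos_notin_nonpos_Ints: "x > 0 \<Longrightarrow> x \<notin> \<int>\<^sub>\<le>\<^sub>0" for x :: real
  by (auto elim!: nonpos_Ints_cases)

text \<open>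
  Substitute \<open>u = \<tau>\<^sup>2\<close> in the integral that represents the Beta function.
\<close>

lemma has_bochner_integral_Beta_sq:
  fixes b :: real
  assumes b: "b > 0"
  shows "has_bochner_integral lborel
    (\<lambda>\<tau>. indicator {0..1} \<tau> * (\<tau> ^ r * (1 - \<tau>\<^sup>2) powr (b - 1))) (Beta ((real r + 1) / 2) b / 2)"
proof -
  define a where "a = (real r + 1) / 2"
  let ?f = "\<lambda>u::real. u powr (a - 1) * (1 - u) powr (b - 1)"
  let ?S = "{0<..<1::real}"
  have a: "a > 0" by (simp add: a_def)
  have Bf: "(?f has_integral Beta a b) ?S"
    using has_integral_Beta_real[OF a b] by (simp add: has_integral_Icc_iff_Ioo)
  have fabs: "?f absolutely_integrable_on ?S"
    by (rule nonnegative_absolutely_integrable_1) (use Bf in auto)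
  have im: "(\<lambda>\<tau>. \<tau>\<^sup>2) ` ?S = ?S"
  proof -
    have "u \<in> (\<lambda>\<tau>. \<tau>\<^sup>2) ` ?S" if "u \<in> ?S" for u
      by (rule image_eqI[of _ _ "sqrt u"]) (use that in auto)
    moreover have "\<tau>\<^sup>2 \<in> ?S" if "\<tau> \<in> ?S" for \<tau> :: real
      using that by (auto simp: abs_square_less_1)
    ultimately show ?thesis by blast
  qed
  have "(\<lambda>\<tau>. \<bar>2 * \<tau>\<bar> * ?f (\<tau>\<^sup>2)) absolutely_integrable_on ?S \<and>
      integral ?S (\<lambda>\<tau>. \<bar>2 * \<tau>\<bar> * ?f (\<tau>\<^sup>2)) = Beta a b"
  proof (rule has_absolute_integral_change_of_variables_1'[where f="?f" and g="\<lambda>\<tau>. \<tau>\<^sup>2" and g'="\<lambda>\<tau>. 2 * \<tau>", THEN iffD2])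
    show "?f absolutely_integrable_on (\<lambda>\<tau>. \<tau>\<^sup>2) ` ?S \<and> integral ((\<lambda>\<tau>. \<tau>\<^sup>2) ` ?S) ?f = Beta a b"
      unfolding im using fabs Bf by (simp add: integral_unique)
  qed (auto intro!: derivative_eq_intros inj_onI)
  then have "((\<lambda>\<tau>. \<bar>2 * \<tau>\<bar> * ?f (\<tau>\<^sup>2)) has_integral Beta a b) ?S"
    unfolding has_integral_iff by (blast dest: set_lebesgue_integral_eq_integral(1))
  then have "((\<lambda>\<tau>. (1 / 2) * (\<bar>2 * \<tau>\<bar> * ?f (\<tau>\<^sup>2))) has_integral (1 / 2) * Beta a b) ?S"
    by (rule has_integral_mult_right)
  moreover have "(1 / 2) * (\<bar>2 * \<tau>\<bar> * ?f (\<tau>\<^sup>2)) = \<tau> ^ r * (1 - \<tau>\<^sup>2) powr (b - 1)" if "\<tau> \<in> ?S" for \<tau>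
  proof -
    have "(\<tau>\<^sup>2) powr (a - 1) = \<tau> powr (real r - 1)"
      using that by (simp add: powr_powr a_def algebra_simps add_divide_distrib diff_divide_distrib flip: powr_numeral)
    then have "\<tau> * (\<tau>\<^sup>2) powr (a - 1) = \<tau> ^ r"
      using that by (simp add: powr_mult_base powr_realpow)
    then show ?thesis using that by simp
  qed
  ultimately have "((\<lambda>\<tau>. \<tau> ^ r * (1 - \<tau>\<^sup>2) powr (b - 1)) has_integral Beta a b / 2) ?S"
    by (subst has_integral_cong[symmetric]) auto
  then have hi01: "((\<lambda>\<tau>. \<tau> ^ r * (1 - \<tau>\<^sup>2) powr (b - 1)) has_integral Beta a b / 2) {0..1}"
    by (simp add: has_integral_Icc_iff_Ioo)
  have hi: "((\<lambda>\<tau>. indicator {0..1} \<tau> * (\<tau> ^ r * (1 - \<tau>\<^sup>2) powr (b - 1))) has_integral Beta a b / 2) UNIV"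
  proof -
    have "(\<lambda>\<tau>. indicator {0..1} \<tau> * (\<tau> ^ r * (1 - \<tau>\<^sup>2) powr (b - 1)))
        = (\<lambda>\<tau>. if \<tau> \<in> {0..1} then \<tau> ^ r * (1 - \<tau>\<^sup>2) powr (b - 1) else 0)"
      by (auto simp: fun_eq_iff)
    then show ?thesis using hi01 by (simp only: has_integral_restrict_UNIV)
  qed
  have nn0: "0 \<le> indicator {0..1} \<tau> * (\<tau> ^ r * (1 - \<tau>\<^sup>2) powr (b - 1))" for \<tau> :: real
    by (auto split: split_indicator)
  have nn: "Beta a b / 2 \<ge> 0"
    by (rule has_integral_nonneg[OF hi]) (rule nn0)
  show ?thesis unfolding a_def[symmetric]
  proof (rule has_bochner_integral_nn_integral)
    show "(\<integral>\<^sup>+ \<tau>. ennreal (indicator {0..1} \<tau> * (\<tau> ^ r * (1 - \<tau>\<^sup>2) powr (b - 1))) \<partial>lborel) = ennreal (Beta a b / 2)"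
      by (rule nn_integral_has_integral_lborel[OF _ nn0 hi]) simp
  qed (use nn nn0 in \<open>auto simp only: AE_I2 divide_nonneg_pos\<close>, measurable)
qed

lemma alternating_binomial_sum_Suc:
  fixes f :: "nat \<Rightarrow> real"
  shows "(\<Sum>l\<le>Suc i. (- 1) ^ l * real (Suc i choose l) * f l)
       = (\<Sum>l\<le>i. (- 1) ^ l * real (i choose l) * (f l - f (Suc l)))"
proof -
  have "(\<Sum>l\<le>Suc i. (- 1) ^ l * real (Suc i choose l) * f l)
      = f 0 + (\<Sum>l\<le>i. (- 1) ^ Suc l * real ((i choose l) + (i choose Suc l)) * f (Suc l))"
    by (subst sum.atMost_Suc_shift) simp
  also have "\<dots> = (f 0 + (\<Sum>l\<le>i. (- 1) ^ Suc l * real (i choose Suc l) * f (Suc l)))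
      - (\<Sum>l\<le>i. (- 1) ^ l * real (i choose l) * f (Suc l))"
    by (simp add: algebra_simps sum.distrib sum_negf sum_subtractf)
  also have "f 0 + (\<Sum>l\<le>i. (- 1) ^ Suc l * real (i choose Suc l) * f (Suc l))
      = (\<Sum>l\<le>Suc i. (- 1) ^ l * real (i choose l) * f l)"
    by (subst sum.atMost_Suc_shift) simp
  also have "\<dots> = (\<Sum>l\<le>i. (- 1) ^ l * real (i choose l) * f l)" by simp
  finally show ?thesis by (simp add: algebra_simps sum_subtractf)
qed

lemma pochhammer_backward_difference:
  fixes y :: real
  shows "pochhammer y s - pochhammer (y - 1) s = real s * pochhammer y (s - 1)"
proof (cases s)
  case (Suc r)
  have "pochhammer (y - 1) (Suc r) = (y - 1) * pochhammer y r"
    using pochhammer_rec[of "y - 1" r] by simp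
  then show ?thesis unfolding Suc by (simp add: pochhammer_rec' algebra_simps)
qed simp

text \<open>
  The left-hand side is the \<open>i\<close>-th backward difference of \<open>\<lambda>y. pochhammer y s\<close>, and rising
  factorials behave under backward differences as powers do under differentiation.
\<close>

lemma alternating_pochhammer_sum:
  fixes y :: real
  shows "(\<Sum>l\<le>i. (- 1) ^ l * real (i choose l) * pochhammer (y - real l) s)
     = fact i * real (s choose i) * pochhammer y (s - i)"
proof (induction i arbitrary: s)
  case (Suc i)
  have d: "pochhammer (y - real l) s - pochhammer (y - real (Suc l)) s = real s * pochhammer (y - real l) (s - 1)" for l
    using pochhammer_backward_difference[of "y - real l" s] by (simp add: algebra_simps)
  have "(\<Sum>l\<le>Suc i. (- 1) ^ l * real (Suc i choose l) * pochhammer (y - real l) s)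
      = real s * (\<Sum>l\<le>i. (- 1) ^ l * real (i choose l) * pochhammer (y - real l) (s - 1))"
    unfolding alternating_binomial_sum_Suc d by (simp add: sum_distrib_left mult_ac)
  also have "\<dots> = (real s * real (s - 1 choose i)) * fact i * pochhammer y (s - 1 - i)"
    unfolding Suc.IH by simp
  also have "real s * real (s - 1 choose i) = real (Suc i) * real (s choose Suc i)"
    unfolding of_nat_mult[symmetric] by (cases s) (simp_all add: Suc_times_binomial_eq mult.commute del: binomial_Suc_Suc mult_Suc mult_Suc_right)
  finally show ?case by (simp add: mult_ac)
qed simp

text \<open>
  The exponent \<open>d - 1\<close> corresponds to the Jacobi parameter \<open>\<beta> = d / 2 - 1\<close>, after the
  substitution \<open>t = 2 * \<tau>\<^sup>2 - 1\<close>.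
\<close>

definition jacobi_weight :: "real \<Rightarrow> nat \<Rightarrow> real \<Rightarrow> real" where
  "jacobi_weight \<alpha> d \<tau> = (1 - \<tau>\<^sup>2) powr \<alpha> * \<tau> ^ (d - 1)"

text \<open>
  Written with Gamma functions, every summand has the same denominator up to a binomial
  coefficient \<open>i choose l\<close> and a rising factorial, which leaves an iterated difference.
\<close>

lemma jacobi_alternating_Beta_sum:
  fixes \<alpha> \<beta> :: real
  assumes "\<alpha> > - 1" "\<beta> > - 1"
  shows "(\<Sum>l\<le>i. (- 1) ^ l * ((real i + \<alpha>) gchoose (i - l)) * ((real i + \<beta>) gchoose l)
            * Beta (\<beta> + 1 + real (s + i - l)) (\<alpha> + 1 + real l))
       = real (s choose i) * Beta (\<beta> + 1 + real s) (\<alpha> + 1 + real i)"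
proof -
  let ?y = "\<beta> + 1 + real i"
  have G0: "Gamma x > 0" if "x > 0" for x :: real using that by (rule Gamma_real_pos)
  have term_eq: "(- 1) ^ l * ((real i + \<alpha>) gchoose (i - l)) * ((real i + \<beta>) gchoose l)
            * Beta (\<beta> + 1 + real (s + i - l)) (\<alpha> + 1 + real l)
     = (Gamma (\<alpha> + 1 + real i) * Gamma ?y / (fact i * Gamma (\<alpha> + \<beta> + 2 + real s + real i)))
       * ((- 1) ^ l * real (i choose l) * pochhammer (?y - real l) s)" if l: "l \<le> i" for l
  proof -
    have il: "real (i - l) = real i - real l" using l by simp
    have 1: "(real i + \<alpha>) gchoose (i - l) = Gamma (\<alpha> + 1 + real i) / (fact (i - l) * Gamma (\<alpha> + 1 + real l))"
      using assms l by (subst gbinomial_Gamma) (auto simp: il algebra_simps elim!: nonpos_Ints_cases)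
    have 2: "(real i + \<beta>) gchoose l = Gamma ?y / (fact l * Gamma (?y - real l))"
      using assms by (subst gbinomial_Gamma) (auto simp: algebra_simps elim!: nonpos_Ints_cases)
    have yl: "?y - real l > 0" using assms l by simp
    have 3: "pochhammer (?y - real l) s = Gamma (?y - real l + real s) / Gamma (?y - real l)"
      using yl by (intro pochhammer_Gamma) (auto elim!: nonpos_Ints_cases)
    have 4: "real (i choose l) = fact i / (fact l * fact (i - l))"
      using binomial_fact[OF l] by simp
    have 5: "\<beta> + 1 + real (s + i - l) = ?y - real l + real s" using l by simp
    have 6: "?y - real l + real s + (\<alpha> + 1 + real l) = \<alpha> + \<beta> + 2 + real s + real i" by simp
    have "Gamma (\<alpha> + 1 + real l) > 0" "Gamma (?y - real l) > 0"
      using G0[OF yl] assms by (auto intro!: G0)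
    then show ?thesis
      unfolding 1 2 3 4 5 Beta_def 6 by (simp add: field_simps)
  qed
  have "(\<Sum>l\<le>i. (- 1) ^ l * ((real i + \<alpha>) gchoose (i - l)) * ((real i + \<beta>) gchoose l)
            * Beta (\<beta> + 1 + real (s + i - l)) (\<alpha> + 1 + real l))
      = (Gamma (\<alpha> + 1 + real i) * Gamma ?y / (fact i * Gamma (\<alpha> + \<beta> + 2 + real s + real i)))
       * (fact i * real (s choose i) * pochhammer ?y (s - i))"
    unfolding alternating_pochhammer_sum[symmetric] sum_distrib_left by (intro sum.cong refl term_eq) auto
  also have "\<dots> = real (s choose i) * Beta (\<beta> + 1 + real s) (\<alpha> + 1 + real i)"
  proof (cases "i \<le> s")
    case True
    have y: "?y > 0" using assms by simp
    have "pochhammer ?y (s - i) = Gamma (?y + real (s - i)) / Gamma ?y"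
      using y by (intro pochhammer_Gamma) (auto elim!: nonpos_Ints_cases)
    moreover have "?y + real (s - i) = \<beta> + 1 + real s" using True by simp
    moreover have "\<beta> + 1 + real s + (\<alpha> + 1 + real i) = \<alpha> + \<beta> + 2 + real s + real i" by simp
    ultimately show ?thesis using G0[OF y] by (simp add: Beta_def field_simps)
  qed (simp add: binomial_eq_0)
  finally show ?thesis .
qed

lemma jacobi_poly_double:
  "jacobi_poly \<alpha> \<beta> i (2 * u - 1) = (\<Sum>l\<le>i. ((real i + \<alpha>) gchoose (i - l)) * ((real i + \<beta>) gchoose l) * (u - 1) ^ l * u ^ (i - l))"
proof -
  have "(2 * u - 1 - 1) / 2 = u - 1" "(2 * u - 1 + 1) / 2 = u" by (simp_all add: field_simps)
  then show ?thesis by (simp only: jacobi_poly_def)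
qed

text \<open>
  Integrating the defining sum of the Jacobi polynomial term by term gives alternating sums of
  Beta values. The result is what Rodrigues' formula and \<open>i\<close> integrations by parts would give;
  it vanishes for \<open>s < i\<close>, which is orthogonality.
\<close>

lemma has_bochner_integral_jacobi_moment:
  assumes \<alpha>: "\<alpha> > - 1" and d: "d > 0" and \<beta>: "\<beta> = real d / 2 - 1"
  shows "has_bochner_integral lborel
     (\<lambda>\<tau>. indicator {0..1} \<tau> * (\<tau> ^ (2 * s) * jacobi_poly \<alpha> \<beta> i (2 * \<tau>\<^sup>2 - 1) * jacobi_weight \<alpha> d \<tau>))
     (real (s choose i) * Beta (\<beta> + 1 + real s) (\<alpha> + 1 + real i) / 2)"
proof -
  let ?c = "\<lambda>l. (- 1) ^ l * ((real i + \<alpha>) gchoose (i - l)) * ((real i + \<beta>) gchoose l)"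
  let ?r = "\<lambda>l. 2 * (s + i - l) + d - 1"
  have \<beta>1: "\<beta> > - 1" using d \<beta> by simp
  have "has_bochner_integral lborel
     (\<lambda>\<tau>. \<Sum>l\<le>i. ?c l * (indicator {0..1} \<tau> * (\<tau> ^ ?r l * (1 - \<tau>\<^sup>2) powr (\<alpha> + 1 + real l - 1))))
     (\<Sum>l\<le>i. ?c l * (Beta ((real (?r l) + 1) / 2) (\<alpha> + 1 + real l) / 2))"
    using \<alpha> by (intro has_bochner_integral_sum has_bochner_integral_mult_right has_bochner_integral_Beta_sq) auto
  also have "(\<Sum>l\<le>i. ?c l * (Beta ((real (?r l) + 1) / 2) (\<alpha> + 1 + real l) / 2))
     = (\<Sum>l\<le>i. ?c l * Beta (\<beta> + 1 + real (s + i - l)) (\<alpha> + 1 + real l)) / 2"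
  proof -
    have "(real (?r l) + 1) / 2 = \<beta> + 1 + real (s + i - l)" for l
    proof -
      have "real (?r l) = 2 * real (s + i - l) + real d - 1" using d by (simp add: of_nat_diff)
      then show ?thesis by (simp add: \<beta> field_simps)
    qed
    then show ?thesis by (simp only: sum_divide_distrib times_divide_eq_right)
  qed
  also have "\<dots> = real (s choose i) * Beta (\<beta> + 1 + real s) (\<alpha> + 1 + real i) / 2"
    unfolding jacobi_alternating_Beta_sum[OF \<alpha> \<beta>1] ..
  also have "(\<lambda>\<tau>. \<Sum>l\<le>i. ?c l * (indicator {0..1} \<tau> * (\<tau> ^ ?r l * (1 - \<tau>\<^sup>2) powr (\<alpha> + 1 + real l - 1))))
    = (\<lambda>\<tau>. indicator {0..1} \<tau> * (\<tau> ^ (2 * s) * jacobi_poly \<alpha> \<beta> i (2 * \<tau>\<^sup>2 - 1) * jacobi_weight \<alpha> d \<tau>))"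
  proof
    fix \<tau> :: real
    show "(\<Sum>l\<le>i. ?c l * (indicator {0..1} \<tau> * (\<tau> ^ ?r l * (1 - \<tau>\<^sup>2) powr (\<alpha> + 1 + real l - 1))))
      = indicator {0..1} \<tau> * (\<tau> ^ (2 * s) * jacobi_poly \<alpha> \<beta> i (2 * \<tau>\<^sup>2 - 1) * jacobi_weight \<alpha> d \<tau>)"
    proof (cases "\<tau> \<in> {0..1}")
      case True
      then have u: "\<tau>\<^sup>2 \<le> 1" by (simp add: power_le_one)
      have key: "?c l * (\<tau> ^ ?r l * (1 - \<tau>\<^sup>2) powr (\<alpha> + 1 + real l - 1))
        = \<tau> ^ (2 * s) * (((real i + \<alpha>) gchoose (i - l)) * ((real i + \<beta>) gchoose l) * (\<tau>\<^sup>2 - 1) ^ l * (\<tau>\<^sup>2) ^ (i - l)) * jacobi_weight \<alpha> d \<tau>"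
        if l: "l \<le> i" for l
      proof -
        have "?r l = 2 * s + 2 * (i - l) + (d - 1)" using l d by simp
        then have 1: "\<tau> ^ ?r l = \<tau> ^ (2 * s) * (\<tau>\<^sup>2) ^ (i - l) * \<tau> ^ (d - 1)"
          by (simp only: power_add power_mult)
        have 2: "(1 - \<tau>\<^sup>2) powr (\<alpha> + 1 + real l - 1) = (1 - \<tau>\<^sup>2) powr \<alpha> * (1 - \<tau>\<^sup>2) ^ l"
        proof (cases "\<tau>\<^sup>2 = 1")
          case False
          then have "1 - \<tau>\<^sup>2 > 0" using u by simp
          then show ?thesis by (simp add: powr_add powr_realpow)
        qed simp
        have 3: "(\<tau>\<^sup>2 - 1) ^ l = (- 1) ^ l * (1 - \<tau>\<^sup>2) ^ l"
          by (simp flip: power_mult_distrib)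
        show ?thesis unfolding 1 2 3 jacobi_weight_def by (simp add: mult_ac)
      qed
      have ind: "indicator {0..1} \<tau> = (1::real)" using True by simp
      have "(\<Sum>l\<le>i. ?c l * (\<tau> ^ ?r l * (1 - \<tau>\<^sup>2) powr (\<alpha> + 1 + real l - 1)))
        = (\<Sum>l\<le>i. \<tau> ^ (2 * s) * (((real i + \<alpha>) gchoose (i - l)) * ((real i + \<beta>) gchoose l) * (\<tau>\<^sup>2 - 1) ^ l * (\<tau>\<^sup>2) ^ (i - l)) * jacobi_weight \<alpha> d \<tau>)"
        by (intro sum.cong refl key) auto
      then show ?thesis unfolding ind mult_1_left jacobi_poly_double
        by (simp only: sum_distrib_left sum_distrib_right)
    qed simp
  qed
  finally show ?thesis .
qed

text \<open>
  By orthogonality only the leading coefficient of one factor matters. As a polynomial in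
  \<open>\<tau>\<^sup>2\<close> the summand with index \<open>l\<close> is monic up to its coefficient, so the leading coefficient is
  a Vandermonde convolution.
\<close>

lemma has_bochner_integral_jacobi_sq:
  assumes \<alpha>: "\<alpha> > - 1" and d: "d > 0" and \<beta>: "\<beta> = real d / 2 - 1"
  shows "has_bochner_integral lborel
     (\<lambda>\<tau>. indicator {0..1} \<tau> * ((jacobi_poly \<alpha> \<beta> i (2 * \<tau>\<^sup>2 - 1))\<^sup>2 * jacobi_weight \<alpha> d \<tau>))
     (((2 * real i + \<alpha> + \<beta>) gchoose i) * Beta (\<beta> + 1 + real i) (\<alpha> + 1 + real i) / 2)"
proof -
  let ?P = "\<lambda>\<tau>. jacobi_poly \<alpha> \<beta> i (2 * \<tau>\<^sup>2 - 1)"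
  let ?C = "\<lambda>l. ((real i + \<alpha>) gchoose (i - l)) * ((real i + \<beta>) gchoose l)"
  let ?M = "\<lambda>s. real (s choose i) * Beta (\<beta> + 1 + real s) (\<alpha> + 1 + real i) / 2"
  have "has_bochner_integral lborel
    (\<lambda>\<tau>. \<Sum>l\<le>i. \<Sum>r\<le>l. (?C l * (real (l choose r) * (- 1) ^ (l - r))) *
       (indicator {0..1} \<tau> * (\<tau> ^ (2 * (r + (i - l))) * ?P \<tau> * jacobi_weight \<alpha> d \<tau>)))
    (\<Sum>l\<le>i. \<Sum>r\<le>l. (?C l * (real (l choose r) * (- 1) ^ (l - r))) * ?M (r + (i - l)))"
    by (intro has_bochner_integral_sum has_bochner_integral_mult_right has_bochner_integral_jacobi_moment assms)
  also have "(\<Sum>l\<le>i. \<Sum>r\<le>l. (?C l * (real (l choose r) * (- 1) ^ (l - r))) * ?M (r + (i - l)))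
     = (\<Sum>l\<le>i. ?C l * ?M i)"
  proof (rule sum.cong)
    fix l assume l: "l \<in> {..i}"
    have "(\<Sum>r\<le>l. (?C l * (real (l choose r) * (- 1) ^ (l - r))) * ?M (r + (i - l)))
        = (\<Sum>r\<le>l. if r = l then ?C l * ?M i else 0)"
    proof (rule sum.cong)
      fix r assume "r \<in> {..l}"
      then show "(?C l * (real (l choose r) * (- 1) ^ (l - r))) * ?M (r + (i - l))
          = (if r = l then ?C l * ?M i else 0)"
        using l by (cases "r = l") (auto simp: binomial_eq_0)
    qed simp
    then show "(\<Sum>r\<le>l. (?C l * (real (l choose r) * (- 1) ^ (l - r))) * ?M (r + (i - l))) = ?C l * ?M i"
      by simp
  qed simp
  also have "\<dots> = (\<Sum>l\<in>{0..i}. ((real i + \<beta>) gchoose l) * ((real i + \<alpha>) gchoose (i - l))) * ?M i"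
    unfolding sum_distrib_right atMost_atLeast0 by (intro sum.cong refl) (simp only: mult_ac)
  also have "\<dots> = ((2 * real i + \<alpha> + \<beta>) gchoose i) * Beta (\<beta> + 1 + real i) (\<alpha> + 1 + real i) / 2"
    unfolding gbinomial_Vandermonde by (simp add: algebra_simps)
  also have "(\<lambda>\<tau>. \<Sum>l\<le>i. \<Sum>r\<le>l. (?C l * (real (l choose r) * (- 1) ^ (l - r))) *
       (indicator {0..1} \<tau> * (\<tau> ^ (2 * (r + (i - l))) * ?P \<tau> * jacobi_weight \<alpha> d \<tau>)))
     = (\<lambda>\<tau>. indicator {0..1} \<tau> * ((?P \<tau>)\<^sup>2 * jacobi_weight \<alpha> d \<tau>))"
  proof
    fix \<tau> :: real
    have b: "(\<tau>\<^sup>2 - 1) ^ l = (\<Sum>r\<le>l. real (l choose r) * (- 1) ^ (l - r) * (\<tau>\<^sup>2) ^ r)" for l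
      using binomial_ring[of "\<tau>\<^sup>2" "- 1" l] by (simp add: mult_ac)
    have "?P \<tau> = (\<Sum>l\<le>i. \<Sum>r\<le>l. (?C l * (real (l choose r) * (- 1) ^ (l - r))) * \<tau> ^ (2 * (r + (i - l))))"
    proof -
      have pw: "\<tau> ^ (2 * (r + (i - l))) = (\<tau>\<^sup>2) ^ r * (\<tau>\<^sup>2) ^ (i - l)" for r l
        by (simp only: power_mult power_add)
      show ?thesis unfolding jacobi_poly_double b pw
        by (simp add: sum_distrib_left sum_distrib_right mult_ac)
    qed
    then have "(?P \<tau>)\<^sup>2 = (\<Sum>l\<le>i. \<Sum>r\<le>l. (?C l * (real (l choose r) * (- 1) ^ (l - r))) * \<tau> ^ (2 * (r + (i - l)))) * ?P \<tau>"
      by (simp add: power2_eq_square)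
    then show "(\<Sum>l\<le>i. \<Sum>r\<le>l. (?C l * (real (l choose r) * (- 1) ^ (l - r))) *
       (indicator {0..1} \<tau> * (\<tau> ^ (2 * (r + (i - l))) * ?P \<tau> * jacobi_weight \<alpha> d \<tau>)))
     = indicator {0..1} \<tau> * ((?P \<tau>)\<^sup>2 * jacobi_weight \<alpha> d \<tau>)"
      by (simp add: sum_distrib_left sum_distrib_right mult_ac)
  qed
  finally show ?thesis .
qed

definition jacobi_moment :: "real \<Rightarrow> real \<Rightarrow> nat \<Rightarrow> nat \<Rightarrow> real" where
  "jacobi_moment \<alpha> \<beta> i s = real (s choose i) * Beta (\<beta> + 1 + real s) (\<alpha> + 1 + real i) / 2"

lemma jacobi_moment_Suc:
  assumes "\<alpha> > - 1" "\<beta> > - 1"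
  shows "(real (Suc s) - real i) * (real (Suc s) + real i + \<alpha> + \<beta> + 1) * jacobi_moment \<alpha> \<beta> i (Suc s)
       = real (Suc s) * (\<beta> + real (Suc s)) * jacobi_moment \<alpha> \<beta> i s"
proof -
  have B: "(real (Suc s) + real i + \<alpha> + \<beta> + 1) * Beta (\<beta> + 1 + real (Suc s)) (\<alpha> + 1 + real i)
      = (\<beta> + real (Suc s)) * Beta (\<beta> + 1 + real s) (\<alpha> + 1 + real i)"
  proof -
    have "\<beta> + 1 + real s \<notin> \<int>\<^sub>\<le>\<^sub>0" using assms(2) by (intro pos_notin_nonpos_Ints) simp
    from Beta_plus1_left[OF this, of "\<alpha> + 1 + real i"]
    show ?thesis by (simp only: of_nat_Suc add_ac)
  qed
  have C: "(real (Suc s) - real i) * real (Suc s choose i) = real (Suc s) * real (s choose i)"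
  proof (cases "i \<le> Suc s")
    case True
    have "real (Suc s - i) * real (Suc s choose i) = real (Suc s) * real (s choose i)"
      using binomial_absorb_comp[of "Suc s" i] unfolding of_nat_mult[symmetric] by simp
    then show ?thesis using True by (simp add: of_nat_diff)
  qed (simp add: binomial_eq_0)
  have "(real (Suc s) - real i) * (real (Suc s) + real i + \<alpha> + \<beta> + 1) * jacobi_moment \<alpha> \<beta> i (Suc s)
    = ((real (Suc s) - real i) * real (Suc s choose i))
      * ((real (Suc s) + real i + \<alpha> + \<beta> + 1) * Beta (\<beta> + 1 + real (Suc s)) (\<alpha> + 1 + real i)) / 2"
    unfolding jacobi_moment_def by (simp only: mult_ac times_divide_eq_right)
  also have "\<dots> = real (Suc s) * (\<beta> + real (Suc s)) * jacobi_moment \<alpha> \<beta> i s"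
    unfolding B C jacobi_moment_def by (simp only: mult_ac times_divide_eq_right)
  finally show ?thesis .
qed

text \<open>
  At \<open>s = i\<close> the binomial coefficient is \<open>1\<close>; these are the first nonzero moments.
\<close>

lemma jacobi_moment_pos:
  assumes "\<alpha> > - 1" "\<beta> > - 1"
  shows "jacobi_moment \<alpha> \<beta> i i > 0"
  using assms by (auto simp: jacobi_moment_def Beta_def intro!: divide_pos_pos mult_pos_pos Gamma_real_pos)

lemma jacobi_poly_1: "jacobi_poly \<alpha> \<beta> i 1 = (real i + \<alpha>) gchoose i"
proof -
  have "jacobi_poly \<alpha> \<beta> i 1 = (\<Sum>s\<le>i. if s = 0 then (real i + \<alpha>) gchoose i else 0)"
    unfolding jacobi_poly_def by (intro sum.cong) auto
  then show ?thesis by simp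
qed

lemma jacobi_poly_bounded:
  obtains R where "\<And>\<tau>. \<tau> \<in> {0..1} \<Longrightarrow> \<bar>jacobi_poly \<alpha> \<beta> i (2 * \<tau>\<^sup>2 - 1)\<bar> \<le> R"
proof -
  have "continuous_on {0..1} (\<lambda>\<tau>::real. jacobi_poly \<alpha> \<beta> i (2 * \<tau>\<^sup>2 - 1))"
    unfolding jacobi_poly_def
    by (intro continuous_on_sum continuous_on_mult continuous_on_power continuous_on_divide
        continuous_on_add continuous_on_diff continuous_on_const continuous_on_id) simp_all
  then have "compact ((\<lambda>\<tau>::real. jacobi_poly \<alpha> \<beta> i (2 * \<tau>\<^sup>2 - 1)) ` {0..1})"
    by (intro compact_continuous_image) auto
  then show ?thesis
    using that compact_imp_bounded[of "(\<lambda>\<tau>::real. jacobi_poly \<alpha> \<beta> i (2 * \<tau>\<^sup>2 - 1)) ` {0..1}"]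
    unfolding bounded_iff by (auto simp del: atLeastAtMost_iff)
qed

lemma gbinomial_Gamma_pos:
  assumes "a - real i > - 1"
  shows "a gchoose i = Gamma (a + 1) / (fact i * Gamma (a - real i + 1))"
  using assms by (intro gbinomial_Gamma) (auto elim!: nonpos_Ints_cases)

text \<open>
  Up to the factor \<open>sphere_area (n - k - 1) * sphere_area k / sphere_area n\<close>, which is cancelled
  by the one inside, \<open>(kappa n k j)\<^sup>2\<close> is the reciprocal of the squared norm of the normalized
  Jacobi polynomial in the weighted \<open>L\<^sup>2\<close> space. The left-hand side contains the squared norm
  of the Jacobi polynomial in its standard normalization.
\<close>

lemma kappa_normalization:
  assumes k: "1 \<le> k" "k < n"
  defines "\<alpha> \<equiv> (real k - 1) / 2" and "\<beta> \<equiv> (real n - real k) / 2 - 1"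
  shows "(kappa n k (2 * i))\<^sup>2 * (sphere_area (n - k - 1) * sphere_area k / sphere_area n)
     * (((2 * real i + \<alpha> + \<beta>) gchoose i) * Beta (\<beta> + 1 + real i) (\<alpha> + 1 + real i) / 2)
     = (jacobi_poly \<alpha> \<beta> i 1)\<^sup>2"
proof -
  have G: "Gamma x > 0" if "x > 0" for x :: real using that by (rule Gamma_real_pos)
  have "real k + 1 \<le> real n" using k by linarith
  then have \<alpha>0: "\<alpha> \<ge> 0" "\<beta> \<ge> - 1 / 2" using k by (simp add: \<alpha>_def, simp add: \<beta>_def field_simps)
  have ab: "\<alpha> + \<beta> + 1 = (real n - 1) / 2" by (simp add: \<alpha>_def \<beta>_def field_simps)
  define A where "A = Gamma (\<alpha> + 1 + real i)"
  define A1 where "A1 = Gamma (\<alpha> + 1)"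
  define B where "B = Gamma (\<beta> + 1 + real i)"
  define E where "E = Gamma (real i + \<alpha> + \<beta> + 1)"
  define Q where "Q = Gamma (2 * real i + \<alpha> + \<beta> + 1)"
  define c where "c = sphere_area (n - k - 1) * sphere_area k / sphere_area n"
  define F where "F = (fact i :: real)"
  define l where "l = 2 * real i + \<alpha> + \<beta> + 1"
  have pos: "A > 0" "A1 > 0" "B > 0" "E > 0" "Q > 0" "F > 0" "l > 0"
  proof -
    have "\<alpha> + \<beta> + 1 > 0" unfolding ab using k by simp
    moreover have "real i \<ge> 0" by simp
    ultimately have args: "\<alpha> + 1 + real i > 0" "\<alpha> + 1 > 0" "\<beta> + 1 + real i > 0"
      "real i + \<alpha> + \<beta> + 1 > 0" "2 * real i + \<alpha> + \<beta> + 1 > 0"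
      using \<alpha>0 by - linarith+
    then show "A > 0" "A1 > 0" "B > 0" "E > 0" "Q > 0" "F > 0" "l > 0"
      by (simp_all add: A_def A1_def B_def E_def Q_def F_def l_def)
  qed
  have sa: "sphere_area r > 0" for r by (auto simp: sphere_area_def intro!: divide_pos_pos G)
  have c: "c > 0" unfolding c_def using sa by (simp add: divide_pos_pos)
  have "(sphere_area n * (2 * real (2 * i) + real n - 1) *
       Gamma ((real (2 * i) + real k + 1) / 2) * Gamma ((real (2 * i) + real n - 1) / 2)) /
      (sphere_area (n - k - 1) * sphere_area k * (Gamma ((real k + 1) / 2))\<^sup>2 *
       Gamma (real (2 * i) / 2 + 1) * Gamma ((real (2 * i) + real n - real k) / 2))
     = (1 / c) * (2 * l * A * E) / (A1\<^sup>2 * F * B)"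
  proof -
    have e1: "2 * real (2 * i) + real n - 1 = 2 * l"
      and e2: "(real (2 * i) + real k + 1) / 2 = \<alpha> + 1 + real i"
      and e3: "(real (2 * i) + real n - 1) / 2 = real i + \<alpha> + \<beta> + 1"
      and e4: "(real k + 1) / 2 = \<alpha> + 1" and e5: "(real (2 * i) + real n - real k) / 2 = \<beta> + 1 + real i"
      by (simp_all add: l_def \<alpha>_def \<beta>_def field_simps)
    have e6: "Gamma (real (2 * i) / 2 + 1) = F" by (simp add: F_def Gamma_fact add.commute)
    show ?thesis
      unfolding e1 e2 e3 e4 e5 e6 A_def A1_def B_def E_def c_def by (simp add: mult_ac)
  qed
  then have kap: "(kappa n k (2 * i))\<^sup>2 = (1 / c) * (2 * l * A * E) / (A1\<^sup>2 * F * B)"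
    unfolding kappa_def using pos c by simp
  have g1: "(2 * real i + \<alpha> + \<beta>) gchoose i = Q / (F * E)"
    using \<alpha>0 by (subst gbinomial_Gamma_pos) (auto simp: Q_def F_def E_def add_ac)
  have g2: "(real i + \<alpha>) gchoose i = A / (F * A1)"
    using \<alpha>0 by (subst gbinomial_Gamma_pos) (auto simp: A_def F_def A1_def add_ac)
  have be: "Beta (\<beta> + 1 + real i) (\<alpha> + 1 + real i) = B * A / (l * Q)"
  proof -
    have s: "\<beta> + 1 + real i + (\<alpha> + 1 + real i) = l + 1" by (simp add: l_def)
    have g: "Gamma (l + 1) = l * Gamma l" using pos by (intro Gamma_plus1) (auto intro!: pos_notin_nonpos_Ints)
    show ?thesis unfolding Beta_def s g by (simp add: A_def B_def Q_def l_def)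
  qed
  show ?thesis
    unfolding kap c_def[symmetric] g1 be jacobi_poly_1 g2 using pos c
    by (simp add: field_simps power2_eq_square)
qed

section \<open>Measures on the unit interval and their even moments\<close>

lemma integrable_bounded_on_unit_interval:
  fixes f :: "real \<Rightarrow> real"
  assumes "finite_measure M" and "sets M = sets borel" and "AE x in M. x \<in> {0..1}"
    and "f \<in> borel_measurable borel" and "\<And>x. x \<in> {0..1} \<Longrightarrow> \<bar>f x\<bar> \<le> K"
  shows "integrable M f"
proof -
  interpret finite_measure M by fact
  have "AE x in M. norm (f x) \<le> K" using assms(3) by eventually_elim (use assms(5) in auto)
  then show ?thesis
    by (rule integrable_const_bound) (use assms(4) in \<open>simp add: measurable_cong_sets[OF assms(2) refl]\<close>)
qed

lemma integral_close_on_unit_interval: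
  fixes f p :: "real \<Rightarrow> real"
  assumes fin: "finite_measure M" and sets: "sets M = sets borel" and supp: "AE x in M. x \<in> {0..1}"
    and f: "f \<in> borel_measurable borel" and fK: "\<And>x. x \<in> {0..1} \<Longrightarrow> \<bar>f x\<bar> \<le> K"
    and p: "p \<in> borel_measurable borel" and e: "\<And>x. x \<in> {0..1} \<Longrightarrow> \<bar>f x - p x\<bar> \<le> e"
  shows "\<bar>(\<integral>x. f x \<partial>M) - (\<integral>x. p x \<partial>M)\<bar> \<le> e * measure M UNIV"
proof -
  interpret finite_measure M by fact
  have pK: "\<bar>p x\<bar> \<le> K + e" if "x \<in> {0..1}" for x
    using fK[OF that] e[OF that] by linarith
  have i: "integrable M f" "integrable M p"
    by (rule integrable_bounded_on_unit_interval[OF fin sets supp f fK], assumption)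
       (rule integrable_bounded_on_unit_interval[OF fin sets supp p pK], assumption)
  have "\<bar>(\<integral>x. f x \<partial>M) - (\<integral>x. p x \<partial>M)\<bar> = \<bar>\<integral>x. f x - p x \<partial>M\<bar>"
    using i by simp
  also have "\<dots> \<le> (\<integral>x. \<bar>f x - p x\<bar> \<partial>M)" by (rule integral_abs_bound)
  also have "\<dots> \<le> (\<integral>x. e \<partial>M)"
  proof (rule integral_mono_AE)
    show "AE x in M. \<bar>f x - p x\<bar> \<le> e" using supp by eventually_elim (rule e)
  qed (use i in auto)
  finally show ?thesis using sets_eq_imp_space_eq[OF sets] by (simp add: mult.commute)
qed

text \<open>
  On the unit interval every continuous function is a uniform limit of polynomials in \<open>x\<^sup>2\<close>: by
  the Weierstrass theorem approximate \<open>\<lambda>u. f (sqrt u)\<close>. So the measures agree on continuous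
  functions, and by approximation from below on half-lines.
\<close>

lemma finite_measure_eqI_even_moments:
  fixes M N :: "real measure"
  assumes fM: "finite_measure M" and fN: "finite_measure N"
    and [measurable_cong]: "sets M = sets borel" "sets N = sets borel"
    and suppM: "AE x in M. x \<in> {0..1}" and suppN: "AE x in N. x \<in> {0..1}"
    and mom: "\<And>s. (\<integral>x. x ^ (2 * s) \<partial>M) = (\<integral>x. x ^ (2 * s) \<partial>N)"
  shows "M = N"
proof -
  interpret M: finite_measure M by (rule fM)
  interpret N: finite_measure N by (rule fN)
  have poly: "(\<integral>x. g (x\<^sup>2) \<partial>M) = (\<integral>x. g (x\<^sup>2) \<partial>N)" if "real_polynomial_function g" for g
  proof -
    obtain c n where g: "g = (\<lambda>x. \<Sum>i\<le>n. c i * x ^ i)"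
      using \<open>real_polynomial_function g\<close> unfolding real_polynomial_function_iff_sum by auto
    have i: "integrable M (\<lambda>x. x ^ (2 * s))" "integrable N (\<lambda>x. x ^ (2 * s))" for s
      by (rule integrable_bounded_on_unit_interval[where K=1, OF fM assms(3) suppM]
            integrable_bounded_on_unit_interval[where K=1, OF fN assms(4) suppN]; simp add: power_le_one)+
    have "(\<integral>x. g (x\<^sup>2) \<partial>M) = (\<Sum>i\<le>n. c i * (\<integral>x. x ^ (2 * i) \<partial>M))"
      unfolding g power_mult[symmetric] using i by (subst Bochner_Integration.integral_sum) auto
    also have "\<dots> = (\<Sum>i\<le>n. c i * (\<integral>x. x ^ (2 * i) \<partial>N))" unfolding mom ..
    also have "\<dots> = (\<integral>x. g (x\<^sup>2) \<partial>N)"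
      unfolding g power_mult[symmetric] using i by (subst Bochner_Integration.integral_sum) auto
    finally show ?thesis .
  qed
  have cont: "(\<integral>x. f x \<partial>M) = (\<integral>x. f x \<partial>N)" if f: "continuous_on UNIV f" for f :: "real \<Rightarrow> real"
  proof -
    have [measurable]: "f \<in> borel_measurable borel" using f by (rule borel_measurable_continuous_onI)
    have "compact (f ` {0..1})"
      using f by (intro compact_continuous_image) (auto intro: continuous_on_subset)
    then obtain K where K: "\<And>x. x \<in> {0..1} \<Longrightarrow> \<bar>f x\<bar> \<le> K"
      using compact_imp_bounded[of "f ` {0..1}"] unfolding bounded_iff by (metis image_eqI real_norm_def)
    define C where "C = measure M UNIV + measure N UNIV"
    have C: "C \<ge> 0" by (simp add: C_def)
    have "\<bar>(\<integral>x. f x \<partial>M) - (\<integral>x. f x \<partial>N)\<bar> \<le> e * C" if e: "e > 0" for e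
    proof -
      have "continuous_on {0..1} (\<lambda>u. f (sqrt u))"
        by (intro continuous_on_compose2[OF f] continuous_intros) auto
      from Stone_Weierstrass_real_polynomial_function[OF compact_Icc this e]
      obtain g where g: "real_polynomial_function g" "\<And>u. u \<in> {0..1} \<Longrightarrow> \<bar>f (sqrt u) - g u\<bar> < e"
        by blast
      have gm [measurable]: "g \<in> borel_measurable borel"
        using continuous_on_polymonial_function[of g UNIV] g(1)
        by (intro borel_measurable_continuous_onI) (auto simp: real_polynomial_function_eq)
      have close: "\<bar>f x - g (x\<^sup>2)\<bar> \<le> e" if "x \<in> {0..1}" for x
        using g(2)[of "x\<^sup>2"] that by (auto simp: power_le_one)
      have gm2: "(\<lambda>x. g (x\<^sup>2)) \<in> borel_measurable borel" by measurable
      have fm: "f \<in> borel_measurable borel" by measurable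
      have "\<bar>(\<integral>x. f x \<partial>M) - (\<integral>x. g (x\<^sup>2) \<partial>M)\<bar> \<le> e * measure M UNIV"
        by (rule integral_close_on_unit_interval[OF fM assms(3) suppM fm _ gm2]) (fact K close)+
      moreover have "\<bar>(\<integral>x. f x \<partial>N) - (\<integral>x. g (x\<^sup>2) \<partial>N)\<bar> \<le> e * measure N UNIV"
        by (rule integral_close_on_unit_interval[OF fN assms(4) suppN fm _ gm2]) (fact K close)+
      ultimately show ?thesis using poly[OF g(1)] by (simp add: C_def distrib_left)
    qed
    note small = this
    show ?thesis
    proof (rule ccontr)
      assume ne: "\<not> ?thesis"
      define D where "D = \<bar>(\<integral>x. f x \<partial>M) - (\<integral>x. f x \<partial>N)\<bar>"
      have D: "D > 0" using ne by (simp add: D_def)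
      have "D \<le> D / (2 * (C + 1)) * C" unfolding D_def by (rule small) (use D C in \<open>simp add: D_def\<close>)
      then have "C * D + D * 2 \<le> 0" using D C by (simp add: field_simps)
      moreover have "C * D \<ge> 0" using D C by simp
      ultimately show False using D by linarith
    qed
  qed
  show ?thesis
  proof (rule measure_eqI_lessThan)
    fix x :: real
    define f where "f = (\<lambda>l t. min 1 (max 0 (real l * (t - x))))"
    have cf: "continuous_on UNIV (f l)" for l unfolding f_def by (intro continuous_intros)
    then have fm [measurable]: "f l \<in> borel_measurable borel" for l by (rule borel_measurable_continuous_onI)
    have lim: "(\<lambda>l. f l t) \<longlonglongrightarrow> indicator {x<..} t" for t
    proof (cases "t > x")
      case True
      have "\<forall>\<^sub>F l in sequentially. real l \<ge> 1 / (t - x)" using filterlim_real_sequentially unfolding filterlim_at_top by blast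
      then have "\<forall>\<^sub>F l in sequentially. f l t = indicator {x<..} t"
        by eventually_elim (use True in \<open>auto simp: f_def field_simps\<close>)
      then show ?thesis by (rule tendsto_eventually)
    next
      case False
      then have "real l * (t - x) \<le> 0" for l by (intro mult_nonneg_nonpos) auto
      then have "f l t = 0" for l by (simp add: f_def max_absorb1)
      then show ?thesis using False by simp
    qed
    have "(\<lambda>l. \<integral>t. f l t \<partial>M) \<longlonglongrightarrow> (\<integral>t. indicator {x<..} t \<partial>M)"
      by (rule integral_dominated_convergence[where w="\<lambda>_. 1"]) (auto simp: lim[unfolded f_def] f_def)
    moreover have "(\<lambda>l. \<integral>t. f l t \<partial>N) \<longlonglongrightarrow> (\<integral>t. indicator {x<..} t \<partial>N)"
      by (rule integral_dominated_convergence[where w="\<lambda>_. 1"]) (auto simp: lim[unfolded f_def] f_def)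
    ultimately have "measure M {x<..} = measure N {x<..}"
      unfolding cont[OF cf] using LIMSEQ_unique by fastforce
    then show "emeasure M {x<..} = emeasure N {x<..}"
      by (simp add: M.emeasure_eq_measure N.emeasure_eq_measure)
    show "emeasure M {x<..} < \<infinity>" by (simp add: M.emeasure_eq_measure)
  qed (use assms in auto)
qed

text \<open>
  The two sides are finite measures on the unit interval, and the hypothesis says exactly
  that their even moments agree.
\<close>

lemma distr_density_eqI_even_moments:
  fixes f :: "'a \<Rightarrow> real" and y :: "'a \<Rightarrow> real" and \<rho> :: "real \<Rightarrow> real"
  assumes "prob_space M"
    and f [measurable]: "f \<in> borel_measurable M" and f01: "AE x in M. f x \<in> {0..1}"
    and y [measurable]: "y \<in> borel_measurable M" and y0: "AE x in M. y x \<ge> 0" and yK: "AE x in M. y x \<le> K"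
    and \<rho>: "integrable lborel \<rho>" and \<rho>0: "\<And>\<tau>. \<rho> \<tau> \<ge> 0" and \<rho>1: "\<And>\<tau>. \<tau> \<notin> {0..1} \<Longrightarrow> \<rho> \<tau> = 0"
    and mom: "\<And>s. (\<integral>x. f x ^ (2 * s) * y x \<partial>M) = (\<integral>\<tau>. \<tau> ^ (2 * s) * \<rho> \<tau> \<partial>lborel)"
  shows "distr (density M y) borel f = density lborel \<rho>"
proof -
  interpret prob_space M by fact
  have [measurable]: "\<rho> \<in> borel_measurable borel" using \<rho> by auto
  have iy: "integrable M y"
    by (rule integrable_const_bound[of _ K]) (use y0 yK in auto)
  show ?thesis
  proof (rule finite_measure_eqI_even_moments)
    have "emeasure (density M y) (space M) = (\<integral>\<^sup>+x. ennreal (y x) \<partial>M)"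
      by (subst emeasure_density) (auto intro!: nn_integral_cong)
    also have "\<dots> = ennreal (\<integral>x. y x \<partial>M)" using iy y0 by (rule nn_integral_eq_integral)
    finally interpret D: finite_measure "density M y"
      by (intro finite_measureI) simp
    show "finite_measure (distr (density M y) borel f)" by (rule D.finite_measure_distr) simp
    show "finite_measure (density lborel \<rho>)"
    proof (rule finite_measureI)
      have "emeasure (density lborel \<rho>) UNIV = (\<integral>\<^sup>+x. ennreal (\<rho> x) \<partial>lborel)"
        by (subst emeasure_density) (auto intro!: nn_integral_cong)
      also have "\<dots> = ennreal (\<integral>x. \<rho> x \<partial>lborel)" using \<rho> \<rho>0 by (intro nn_integral_eq_integral) auto
      finally show "emeasure (density lborel \<rho>) (space (density lborel \<rho>)) \<noteq> \<infinity>" by simp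
    qed
    show "AE x in distr (density M y) borel f. x \<in> {0..1}"
      using f01 by (subst AE_distr_iff) (auto simp: AE_density)
    show "AE x in density lborel \<rho>. x \<in> {0..1}"
      using \<rho>1 by (subst AE_density) (auto intro!: AE_I2, force+)
    fix s
    have "(\<integral>x. x ^ (2 * s) \<partial>distr (density M y) borel f) = (\<integral>x. y x * f x ^ (2 * s) \<partial>M)"
      using y0 by (subst integral_distr) (auto simp: integral_density)
    also have "\<dots> = (\<integral>x. x ^ (2 * s) \<partial>density lborel \<rho>)"
      using mom[of s] \<rho>0 by (subst integral_density) (auto simp: mult.commute)
    finally show "(\<integral>x. x ^ (2 * s) \<partial>distr (density M y) borel f) = (\<integral>x. x ^ (2 * s) \<partial>density lborel \<rho>)" .
  qed simp_all
qed

lemma integral_compose_density: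
  fixes f :: "'a \<Rightarrow> real" and y :: "'a \<Rightarrow> real" and \<rho> :: "real \<Rightarrow> real" and h :: "real \<Rightarrow> complex"
  assumes eq: "distr (density M y) borel f = density lborel \<rho>"
    and f [measurable]: "f \<in> borel_measurable M" and y [measurable]: "y \<in> borel_measurable M"
    and y0: "AE x in M. y x \<ge> 0" and \<rho>0: "\<And>\<tau>. \<rho> \<tau> \<ge> 0"
    and \<rho> [measurable]: "\<rho> \<in> borel_measurable borel" and h [measurable]: "h \<in> borel_measurable borel"
  shows "integrable M (\<lambda>x. y x *\<^sub>R h (f x)) \<longleftrightarrow> integrable lborel (\<lambda>\<tau>. \<rho> \<tau> *\<^sub>R h \<tau>)"
    and "(\<integral>x. y x *\<^sub>R h (f x) \<partial>M) = (\<integral>\<tau>. \<rho> \<tau> *\<^sub>R h \<tau> \<partial>lborel)"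
proof -
  have "integrable M (\<lambda>x. y x *\<^sub>R h (f x)) \<longleftrightarrow> integrable (distr (density M y) borel f) h"
    using y0 by (subst integrable_distr_eq) (auto simp: integrable_density)
  also have "\<dots> \<longleftrightarrow> integrable lborel (\<lambda>\<tau>. \<rho> \<tau> *\<^sub>R h \<tau>)"
    unfolding eq using \<rho>0 by (subst integrable_density) auto
  finally show "integrable M (\<lambda>x. y x *\<^sub>R h (f x)) \<longleftrightarrow> integrable lborel (\<lambda>\<tau>. \<rho> \<tau> *\<^sub>R h \<tau>)" .
  have "(\<integral>x. y x *\<^sub>R h (f x) \<partial>M) = (\<integral>\<tau>. h \<tau> \<partial>distr (density M y) borel f)"
    using y0 by (subst integral_distr) (auto simp: integral_density)
  also have "\<dots> = (\<integral>\<tau>. \<rho> \<tau> *\<^sub>R h \<tau> \<partial>lborel)"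
    unfolding eq using \<rho>0 by (subst integral_density) auto
  finally show "(\<integral>x. y x *\<^sub>R h (f x) \<partial>M) = (\<integral>\<tau>. \<rho> \<tau> *\<^sub>R h \<tau> \<partial>lborel)" .
qed

text \<open>
  If \<open>f\<close> has law \<open>c * w\<close>, the moments of the signed measure \<open>y M\<close> pushed forward by \<open>f\<close>
  identify it as \<open>r * w\<close>. Signed measures are avoided by adding to \<open>y\<close> a constant \<open>K\<close>, whose
  contribution is known because the law of \<open>f\<close> is.
\<close>

lemma integral_compose_even_moments_real:
  fixes f :: "'a \<Rightarrow> real" and y :: "'a \<Rightarrow> real" and w r :: "real \<Rightarrow> real" and h :: "real \<Rightarrow> complex"
  assumes "prob_space M"
    and f [measurable]: "f \<in> borel_measurable M" and f01: "AE x in M. f x \<in> {0..1}"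
    and w: "integrable lborel w" and w0: "\<And>\<tau>. w \<tau> \<ge> 0" and w1: "\<And>\<tau>. \<tau> \<notin> {0..1} \<Longrightarrow> w \<tau> = 0"
    and c: "c > 0" and base: "distr M borel f = density lborel (\<lambda>\<tau>. c * w \<tau>)"
    and y [measurable]: "y \<in> borel_measurable M" and yK: "AE x in M. \<bar>y x\<bar> \<le> Ky"
    and r [measurable]: "r \<in> borel_measurable borel" and rR: "\<And>\<tau>. \<tau> \<in> {0..1} \<Longrightarrow> \<bar>r \<tau>\<bar> \<le> R"
    and mom: "\<And>s. (\<integral>x. f x ^ (2 * s) * y x \<partial>M) = (\<integral>\<tau>. \<tau> ^ (2 * s) * (r \<tau> * w \<tau>) \<partial>lborel)"
    and h [measurable]: "h \<in> borel_measurable borel" and ih: "integrable lborel (\<lambda>\<tau>. w \<tau> *\<^sub>R h \<tau>)"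
  shows "integrable M (\<lambda>x. y x *\<^sub>R h (f x))"
    and "(\<integral>x. y x *\<^sub>R h (f x) \<partial>M) = (\<integral>\<tau>. (r \<tau> * w \<tau>) *\<^sub>R h \<tau> \<partial>lborel)"
proof -
  interpret prob_space M by fact
  have [measurable]: "w \<in> borel_measurable borel" using w by auto
  have R0: "R \<ge> 0" using rR[of 0] by simp
  \<comment> \<open>Large enough that \<open>y + K\<close> is nonnegative almost everywhere and \<open>r + K * c\<close> on the unit interval.\<close>
  define K where "K = \<bar>Ky\<bar> + R / c"
  have "R / c \<ge> 0" using c R0 by simp
  then have Kc: "K \<ge> \<bar>Ky\<bar>" "K \<ge> 0" by (simp_all add: K_def)
  have Kc1: "K * c \<ge> R" using c by (simp add: K_def distrib_right)
  have iwr: "integrable lborel (\<lambda>\<tau>. \<tau> ^ s * (q \<tau> * w \<tau>))"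
    if [measurable]: "q \<in> borel_measurable borel" and "\<And>\<tau>. \<tau> \<in> {0..1} \<Longrightarrow> \<bar>q \<tau>\<bar> \<le> Q" for q Q s
  proof (rule Bochner_Integration.integrable_bound)
    show "integrable lborel (\<lambda>\<tau>. Q * w \<tau>)" using w by simp
    show "AE \<tau> in lborel. norm (\<tau> ^ s * (q \<tau> * w \<tau>)) \<le> norm (Q * w \<tau>)"
    proof (rule AE_I2)
      fix \<tau> :: real
      show "norm (\<tau> ^ s * (q \<tau> * w \<tau>)) \<le> norm (Q * w \<tau>)"
      proof (cases "\<tau> \<in> {0..1}")
        case True
        have "\<bar>\<tau> ^ s\<bar> * (\<bar>q \<tau>\<bar> * \<bar>w \<tau>\<bar>) \<le> 1 * (\<bar>Q\<bar> * \<bar>w \<tau>\<bar>)"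
          using True that(2)[OF True] by (intro mult_mono mult_right_mono) (auto simp: power_le_one)
        then show ?thesis by (simp add: abs_mult)
      qed (simp add: w1)
    qed
  qed simp
  have iM: "integrable M (\<lambda>x. f x ^ s * g x)"
    if [measurable]: "g \<in> borel_measurable M" and "AE x in M. \<bar>g x\<bar> \<le> L" for g L s
  proof (rule integrable_const_bound[where B="\<bar>L\<bar>"])
    show "AE x in M. norm (f x ^ s * g x) \<le> \<bar>L\<bar>"
      using f01 that(2)
    proof eventually_elim
      fix x assume "f x \<in> {0..1}" "\<bar>g x\<bar> \<le> L"
      then have "\<bar>f x ^ s\<bar> * \<bar>g x\<bar> \<le> 1 * \<bar>L\<bar>" by (intro mult_mono) (auto simp: power_le_one)
      then show "norm (f x ^ s * g x) \<le> \<bar>L\<bar>" by (simp add: abs_mult)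
    qed
  qed simp
  let ?\<rho> = "\<lambda>\<tau>. (r \<tau> + K * c) * w \<tau>"
  have \<rho>0: "?\<rho> \<tau> \<ge> 0" for \<tau>
    using rR[of \<tau>] w0[of \<tau>] w1[of \<tau>] Kc1 by (cases "\<tau> \<in> {0..1}") (auto intro!: mult_nonneg_nonneg)
  have base_mom: "(\<integral>x. f x ^ s \<partial>M) = c * (\<integral>\<tau>. \<tau> ^ s * w \<tau> \<partial>lborel)" for s
  proof -
    have "(\<integral>x. f x ^ s \<partial>M) = (\<integral>\<tau>. \<tau> ^ s \<partial>distr M borel f)" by (subst integral_distr) auto
    also have "\<dots> = (\<integral>\<tau>. c * (\<tau> ^ s * w \<tau>) \<partial>lborel)"
      unfolding base using c w0 by (subst integral_density) (auto simp: mult_ac)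
    finally show ?thesis by simp
  qed
  have y0: "AE x in M. y x + K \<ge> 0" using yK by eventually_elim (use Kc in auto)
  have eq: "distr (density M (\<lambda>x. y x + K)) borel f = density lborel ?\<rho>"
  proof (rule distr_density_eqI_even_moments[where K="\<bar>Ky\<bar> + K"])
    show "AE x in M. y x + K \<le> \<bar>Ky\<bar> + K" using yK by eventually_elim auto
    show "integrable lborel ?\<rho>"
      using iwr[of r R 0] w rR by (simp add: distrib_right)
    fix s
    have "(\<integral>x. f x ^ (2 * s) * (y x + K) \<partial>M) = (\<integral>x. f x ^ (2 * s) * y x + K * f x ^ (2 * s) \<partial>M)"
      by (simp add: algebra_simps)
    also have "\<dots> = (\<integral>x. f x ^ (2 * s) * y x \<partial>M) + K * (\<integral>x. f x ^ (2 * s) \<partial>M)"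
      using iM[of y Ky "2 * s"] iM[of "\<lambda>_. 1" 1 "2 * s"] yK by simp
    also have "\<dots> = (\<integral>\<tau>. \<tau> ^ (2 * s) * (r \<tau> * w \<tau>) \<partial>lborel) + K * c * (\<integral>\<tau>. \<tau> ^ (2 * s) * w \<tau> \<partial>lborel)"
      unfolding mom base_mom by simp
    also have "\<dots> = (\<integral>\<tau>. \<tau> ^ (2 * s) * (r \<tau> * w \<tau>) + K * c * (\<tau> ^ (2 * s) * w \<tau>) \<partial>lborel)"
      using iwr[of r R "2 * s"] iwr[of "\<lambda>_. 1" 1 "2 * s"] rR by simp
    also have "\<dots> = (\<integral>\<tau>. \<tau> ^ (2 * s) * ?\<rho> \<tau> \<partial>lborel)" by (simp add: algebra_simps)
    finally show "(\<integral>x. f x ^ (2 * s) * (y x + K) \<partial>M) = (\<integral>\<tau>. \<tau> ^ (2 * s) * ?\<rho> \<tau> \<partial>lborel)" .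
  qed (use assms(1) f01 y0 \<rho>0 w1 in auto)
  have base': "distr (density M (\<lambda>x. ennreal 1)) borel f = density lborel (\<lambda>\<tau>. c * w \<tau>)"
    using base by (simp add: density_1)
  have ihr: "integrable lborel (\<lambda>\<tau>. (r \<tau> * w \<tau>) *\<^sub>R h \<tau>)"
  proof (rule Bochner_Integration.integrable_bound)
    show "integrable lborel (\<lambda>\<tau>. R *\<^sub>R (w \<tau> *\<^sub>R h \<tau>))" using ih by (rule integrable_scaleR_right)
    show "AE \<tau> in lborel. norm ((r \<tau> * w \<tau>) *\<^sub>R h \<tau>) \<le> norm (R *\<^sub>R (w \<tau> *\<^sub>R h \<tau>))"
    proof (rule AE_I2)
      fix \<tau> :: real
      show "norm ((r \<tau> * w \<tau>) *\<^sub>R h \<tau>) \<le> norm (R *\<^sub>R (w \<tau> *\<^sub>R h \<tau>))"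
        using rR[of \<tau>] w1[of \<tau>] R0
        by (cases "\<tau> \<in> {0..1}") (auto simp: abs_mult mult.assoc intro!: mult_right_mono)
    qed
  qed simp
  have 1: "integrable M (\<lambda>x. h (f x))" "(\<integral>x. h (f x) \<partial>M) = c *\<^sub>R (\<integral>\<tau>. w \<tau> *\<^sub>R h \<tau> \<partial>lborel)"
    using integral_compose_density[OF base', where h=h] c w0 ih
    by (auto simp flip: scaleR_scaleR)
  have \<rho>h: "?\<rho> \<tau> *\<^sub>R h \<tau> = (r \<tau> * w \<tau>) *\<^sub>R h \<tau> + (K * c) *\<^sub>R (w \<tau> *\<^sub>R h \<tau>)" for \<tau>
    by (simp add: distrib_right scaleR_add_left)
  have i\<rho>h: "integrable lborel (\<lambda>\<tau>. ?\<rho> \<tau> *\<^sub>R h \<tau>)"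
    unfolding \<rho>h using ihr ih by (intro Bochner_Integration.integrable_add integrable_scaleR_right)
  have 2: "integrable M (\<lambda>x. (y x + K) *\<^sub>R h (f x))"
    "(\<integral>x. (y x + K) *\<^sub>R h (f x) \<partial>M) = (\<integral>\<tau>. ?\<rho> \<tau> *\<^sub>R h \<tau> \<partial>lborel)"
    using integral_compose_density[OF eq, where h=h] y0 \<rho>0 i\<rho>h by auto
  have yh: "y x *\<^sub>R h (f x) = (y x + K) *\<^sub>R h (f x) - K *\<^sub>R h (f x)" for x
    by (simp add: scaleR_add_left)
  show "integrable M (\<lambda>x. y x *\<^sub>R h (f x))"
    unfolding yh using 1 2 by (intro Bochner_Integration.integrable_diff integrable_scaleR_right)
  have "(\<integral>x. y x *\<^sub>R h (f x) \<partial>M) = (\<integral>x. (y x + K) *\<^sub>R h (f x) \<partial>M) - K *\<^sub>R (\<integral>x. h (f x) \<partial>M)"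
    unfolding yh using 1 2 by (subst Bochner_Integration.integral_diff) (auto intro: integrable_scaleR_right)
  also have "\<dots> = (\<integral>\<tau>. ?\<rho> \<tau> *\<^sub>R h \<tau> \<partial>lborel) - (K * c) *\<^sub>R (\<integral>\<tau>. w \<tau> *\<^sub>R h \<tau> \<partial>lborel)"
    unfolding 1 2 by simp
  also have "\<dots> = (\<integral>\<tau>. (r \<tau> * w \<tau>) *\<^sub>R h \<tau> \<partial>lborel)"
    unfolding \<rho>h using ihr ih
    by (subst Bochner_Integration.integral_add) (auto simp del: scaleR_scaleR intro: integrable_scaleR_right)
  finally show "(\<integral>x. y x *\<^sub>R h (f x) \<partial>M) = (\<integral>\<tau>. (r \<tau> * w \<tau>) *\<^sub>R h \<tau> \<partial>lborel)" .
qed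

lemma integral_compose_even_moments_complex:
  fixes f :: "'a \<Rightarrow> real" and p :: "'a \<Rightarrow> complex" and w r :: "real \<Rightarrow> real" and h :: "real \<Rightarrow> complex"
  assumes "prob_space M"
    and f [measurable]: "f \<in> borel_measurable M" and f01: "AE x in M. f x \<in> {0..1}"
    and w: "integrable lborel w" and w0: "\<And>\<tau>. w \<tau> \<ge> 0" and w1: "\<And>\<tau>. \<tau> \<notin> {0..1} \<Longrightarrow> w \<tau> = 0"
    and c: "c > 0" and base: "distr M borel f = density lborel (\<lambda>\<tau>. c * w \<tau>)"
    and p [measurable]: "p \<in> borel_measurable M" and pK: "AE x in M. norm (p x) \<le> Kp"
    and r [measurable]: "r \<in> borel_measurable borel" and rR: "\<And>\<tau>. \<tau> \<in> {0..1} \<Longrightarrow> \<bar>r \<tau>\<bar> \<le> R"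
    and mom: "\<And>s. (\<integral>x. of_real (f x ^ (2 * s)) * p x \<partial>M) = C * of_real (\<integral>\<tau>. \<tau> ^ (2 * s) * (r \<tau> * w \<tau>) \<partial>lborel)"
    and h [measurable]: "h \<in> borel_measurable borel" and ih: "integrable lborel (\<lambda>\<tau>. w \<tau> *\<^sub>R h \<tau>)"
  shows "integrable M (\<lambda>x. h (f x) * p x)"
    and "(\<integral>x. h (f x) * p x \<partial>M) = C * (\<integral>\<tau>. (r \<tau> * w \<tau>) *\<^sub>R h \<tau> \<partial>lborel)"
proof -
  interpret prob_space M by fact
  have ip: "integrable M (\<lambda>x. of_real (f x ^ s) * p x)" for s
  proof (rule integrable_const_bound[where B="Kp"])
    show "AE x in M. norm (of_real (f x ^ s) * p x) \<le> Kp"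
      using f01 pK
    proof eventually_elim
      fix x assume "f x \<in> {0..1}" "norm (p x) \<le> Kp"
      then have "\<bar>f x ^ s\<bar> * norm (p x) \<le> 1 * Kp" by (intro mult_mono) (auto simp: power_le_one)
      then show "norm (of_real (f x ^ s) * p x) \<le> Kp" by (simp add: norm_mult norm_power power_abs)
    qed
  qed simp
  let ?I = "\<integral>\<tau>. (r \<tau> * w \<tau>) *\<^sub>R h \<tau> \<partial>lborel"
  have part: "integrable M (\<lambda>x. y x *\<^sub>R h (f x))" "(\<integral>x. y x *\<^sub>R h (f x) \<partial>M) = cr *\<^sub>R ?I"
    if [measurable]: "y \<in> borel_measurable M" and "\<And>x. \<bar>y x\<bar> \<le> norm (p x)"
      and m: "\<And>s. (\<integral>x. f x ^ (2 * s) * y x \<partial>M) = cr * (\<integral>\<tau>. \<tau> ^ (2 * s) * (r \<tau> * w \<tau>) \<partial>lborel)" for y cr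
  proof -
    have yK: "AE x in M. \<bar>y x\<bar> \<le> Kp" using pK by eventually_elim (use that(2) order_trans in blast)
    have r': "(\<lambda>\<tau>. cr * r \<tau>) \<in> borel_measurable borel" by measurable
    have rR': "\<bar>cr * r \<tau>\<bar> \<le> \<bar>cr\<bar> * R" if "\<tau> \<in> {0..1}" for \<tau>
      using rR[OF that] by (simp add: abs_mult mult_left_mono)
    have m': "(\<integral>x. f x ^ (2 * s) * y x \<partial>M) = (\<integral>\<tau>. \<tau> ^ (2 * s) * ((cr * r \<tau>) * w \<tau>) \<partial>lborel)" for s
    proof -
      have "(\<integral>\<tau>. \<tau> ^ (2 * s) * ((cr * r \<tau>) * w \<tau>) \<partial>lborel) = (\<integral>\<tau>. cr * (\<tau> ^ (2 * s) * (r \<tau> * w \<tau>)) \<partial>lborel)"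
        by (simp add: mult_ac)
      then show ?thesis unfolding m by simp
    qed
    note tr = integral_compose_even_moments_real[OF assms(1) f f01 w w0 w1 c base that(1) yK r' rR' m' h ih]
    show "integrable M (\<lambda>x. y x *\<^sub>R h (f x))" by (rule tr(1))
    have "(\<integral>x. y x *\<^sub>R h (f x) \<partial>M) = (\<integral>\<tau>. cr *\<^sub>R ((r \<tau> * w \<tau>) *\<^sub>R h \<tau>) \<partial>lborel)"
      using tr(2) by (simp add: mult.assoc)
    also have "\<dots> = cr *\<^sub>R ?I" by (rule integral_scaleR_right)
    finally show "(\<integral>x. y x *\<^sub>R h (f x) \<partial>M) = cr *\<^sub>R ?I" .
  qed
  have mRe: "(\<integral>x. f x ^ (2 * s) * Re (p x) \<partial>M) = Re C * (\<integral>\<tau>. \<tau> ^ (2 * s) * (r \<tau> * w \<tau>) \<partial>lborel)" for s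
    using arg_cong[OF mom[of s], of Re] integral_Re[OF ip[of "2 * s"]] by simp
  have mIm: "(\<integral>x. f x ^ (2 * s) * Im (p x) \<partial>M) = Im C * (\<integral>\<tau>. \<tau> ^ (2 * s) * (r \<tau> * w \<tau>) \<partial>lborel)" for s
    using arg_cong[OF mom[of s], of Im] integral_Im[OF ip[of "2 * s"]] by simp
  have R: "integrable M (\<lambda>x. Re (p x) *\<^sub>R h (f x))" "(\<integral>x. Re (p x) *\<^sub>R h (f x) \<partial>M) = Re C *\<^sub>R ?I"
    by (rule part[OF _ _ mRe]; simp add: abs_Re_le_cmod)+
  have I: "integrable M (\<lambda>x. Im (p x) *\<^sub>R h (f x))" "(\<integral>x. Im (p x) *\<^sub>R h (f x) \<partial>M) = Im C *\<^sub>R ?I"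
    by (rule part[OF _ _ mIm]; simp add: abs_Im_le_cmod)+
  have split: "h (f x) * p x = Re (p x) *\<^sub>R h (f x) + \<i> * (Im (p x) *\<^sub>R h (f x))" for x
    by (subst (3) complex_eq) (simp add: scaleR_conv_of_real algebra_simps)
  show "integrable M (\<lambda>x. h (f x) * p x)"
    unfolding split using R I by (intro Bochner_Integration.integrable_add integrable_mult_right)
  have "(\<integral>x. h (f x) * p x \<partial>M) = Re C *\<^sub>R ?I + \<i> * (Im C *\<^sub>R ?I)"
    unfolding split R(2)[symmetric] I(2)[symmetric] using R(1) I(1)
    by (simp only: Bochner_Integration.integral_add Bochner_Integration.integrable_mult_right
        Bochner_Integration.integral_mult_right_zero)
  also have "\<dots> = (of_real (Re C) + \<i> * of_real (Im C)) * ?I"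
    by (simp add: scaleR_conv_of_real distrib_right mult.assoc)
  also have "\<dots> = C * ?I" by (simp only: complex_eq[symmetric])
  finally show "(\<integral>x. h (f x) * p x \<partial>M) = C * ?I" .
qed

text \<open>
  A function that agrees almost everywhere with a measurable one is measurable and has the
  same integral once the measure is completed. This is how a merely Lebesgue measurable
  profile enters: everything is proved for a Borel representative on the uncompleted measure.
\<close>

lemma completion_integral_cong_AE:
  fixes G g :: "'a \<Rightarrow> complex"
  assumes g: "g \<in> borel_measurable M" and eq: "AE x in M. G x = g x"
  shows "G \<in> borel_measurable (completion M)"
    and "integrable (completion M) G \<longleftrightarrow> integrable M g"
    and "integral\<^sup>L (completion M) G = integral\<^sup>L M g"
proof -
  have eqc: "AE x in completion M. G x = g x" using eq by (rule AE_completion)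
  have gc: "g \<in> borel_measurable (completion M)" using g by (rule measurable_completion)
  show Gc: "G \<in> borel_measurable (completion M)"
  proof (rule measurableI)
    fix A :: "complex set" assume A: "A \<in> sets borel"
    show "G -` A \<inter> space (completion M) \<in> sets (completion M)"
    proof (rule completion.in_sets_AE)
      show "g -` A \<inter> space (completion M) \<in> sets (completion M)"
        using gc A by (rule measurable_sets)
      show "AE x in completion M. (x \<in> g -` A \<inter> space (completion M)) = (x \<in> G -` A \<inter> space (completion M))"
        using eqc by eventually_elim auto
    qed simp
  qed simp
  have "integrable (completion M) G \<longleftrightarrow> integrable (completion M) g"
    using eqc Gc gc by (intro integrable_cong_AE) auto
  also have "\<dots> \<longleftrightarrow> integrable M g"
    using g gc by (simp add: integrable_iff_bounded nn_integral_completion)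
  finally show "integrable (completion M) G \<longleftrightarrow> integrable M g" .
  have "integral\<^sup>L (completion M) G = integral\<^sup>L (completion M) g"
    using eqc Gc gc by (intro integral_cong_AE) auto
  also have "\<dots> = integral\<^sup>L M g" using g by (rule integral_completion)
  finally show "integral\<^sup>L (completion M) G = integral\<^sup>L M g" .
qed

lemma ex_borel_representative:
  fixes a :: "real \<Rightarrow> complex"
  assumes "a \<in> borel_measurable (lebesgue_on {0..1})"
  obtains a' where "a' \<in> borel_measurable borel" "AE \<tau> in lborel. \<tau> \<in> {0..1} \<longrightarrow> a \<tau> = a' \<tau>"
proof -
  have m: "(\<lambda>\<tau>. indicator {0..1} \<tau> *\<^sub>R a \<tau>) \<in> borel_measurable lebesgue"
    using assms by (subst (asm) borel_measurable_restrict_space_iff) auto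
  have "(\<lambda>\<tau>. Re (indicator {0..1} \<tau> *\<^sub>R a \<tau>)) \<in> borel_measurable lebesgue"
    "(\<lambda>\<tau>. Im (indicator {0..1} \<tau> *\<^sub>R a \<tau>)) \<in> borel_measurable lebesgue"
    using measurable_compose[OF m borel_measurable_Re] measurable_compose[OF m borel_measurable_Im] by auto
  from this[THEN completion_ex_borel_measurable_real] obtain u t where
    u: "u \<in> borel_measurable lborel" "AE \<tau> in lborel. Re (indicator {0..1} \<tau> *\<^sub>R a \<tau>) = u \<tau>" and
    t: "t \<in> borel_measurable lborel" "AE \<tau> in lborel. Im (indicator {0..1} \<tau> *\<^sub>R a \<tau>) = t \<tau>" by blast
  show ?thesis
  proof
    have [measurable]: "u \<in> borel_measurable borel" "t \<in> borel_measurable borel" using u t by auto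
    show "(\<lambda>\<tau>. of_real (u \<tau>) + \<i> * of_real (t \<tau>)) \<in> borel_measurable borel" by measurable
    show "AE \<tau> in lborel. \<tau> \<in> {0..1} \<longrightarrow> a \<tau> = of_real (u \<tau>) + \<i> * of_real (t \<tau>)"
      using u(2) t(2) by eventually_elim (auto simp: complex_eq_iff)
  qed
qed

section \<open>Integrals of harmonics against functions of the projected length\<close>

text \<open>
  In the recurrence for the moments of a harmonic of degree \<open>j\<close> the leading coefficient is a
  multiple of \<open>2 * s - j\<close>. If \<open>j\<close> is odd it never vanishes, and the recurrence, whose
  right-hand side is \<open>0\<close> at \<open>s = 0\<close>, kills every moment. If \<open>j\<close> is even, the moments with
  \<open>2 * s < j\<close> vanish, the one with \<open>2 * s = j\<close> is free, and all later ones are determined by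
  it. The Jacobi moments satisfy the same recurrence and are nonzero at the free index, so the
  two sequences are proportional.
\<close>

lemma sphere_moment_eq_jacobi_moment:
  fixes v :: "real ^ 'm ^ 'n" and p :: "real ^ 'n \<Rightarrow> complex"
  assumes v: "v \<in> stiefel" and p: "polynomial_function p"
    and hom: "\<And>c x. p (c *\<^sub>R x) = c ^ j *\<^sub>R p x" and harm: "\<And>x. laplacian p x = 0"
    and N: "CARD('n) \<ge> 2"
    and \<beta>: "\<beta> = real CARD('m) / 2 - 1" and \<alpha>: "\<alpha> = (real CARD('n) - real CARD('m)) / 2 - 1" "\<alpha> > - 1"
  shows "if even j
    then \<exists>C. \<forall>s. sphere_moment v p s = C * of_real (jacobi_moment \<alpha> \<beta> (j div 2) s)
    else \<forall>s. sphere_moment v p s = 0"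
proof -
  let ?M = "sphere_moment v p"
  note green = sphere_moment_recurrence[OF v p hom harm]
  have \<beta>1: "\<beta> > - 1" using \<beta> by simp
  \<comment> \<open>The recurrence at \<open>s = 0\<close>: a harmonic of positive degree has mean value zero.\<close>
  have M0: "?M 0 = 0" if "j > 0"
  proof -
    have "(real j * (real j + real CARD('n) - 2)) *\<^sub>R ?M 0 = 0"
      using green[of 0] by simp
    moreover have "real j * (real j + real CARD('n) - 2) \<noteq> 0" using that N by auto
    ultimately show ?thesis by simp
  qed
  have step: "?M (Suc s) = (2 * real (Suc s) * (2 * real (Suc s) + real CARD('m) - 2)
        / ((2 * real (Suc s) - real j) * (2 * real (Suc s) + real j + real CARD('n) - 2))) *\<^sub>R ?M s"
    if "2 * Suc s \<noteq> j" for s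
  proof -
    have "2 * real (Suc s) - real j \<noteq> 0" using that by (metis eq_iff_diff_eq_0 of_nat_eq_iff of_nat_mult of_nat_numeral)
    moreover have "2 * real (Suc s) + real j + real CARD('n) - 2 \<noteq> 0" using N by auto
    ultimately show ?thesis
      using arg_cong[OF green[of "Suc s"], of "scaleR (1 / ((2 * real (Suc s) - real j) * (2 * real (Suc s) + real j + real CARD('n) - 2)))"]
      by simp
  qed
  show ?thesis
  proof (cases "even j")
    case True
    define i where "i = j div 2"
    have j: "j = 2 * i" using True by (simp add: i_def)
    define C where "C = ?M i / of_real (jacobi_moment \<alpha> \<beta> i i)"
    have J: "jacobi_moment \<alpha> \<beta> i i > 0" using \<alpha>(2) \<beta>1 by (rule jacobi_moment_pos)
    have "?M s = C * of_real (jacobi_moment \<alpha> \<beta> i s)" for s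
    proof (induction s)
      case 0
      show ?case using M0 J by (cases "i = 0") (auto simp: j C_def jacobi_moment_def)
    next
      case (Suc s)
      show ?case
      proof (cases "Suc s = i")
        case False
        define A where "A = (real (Suc s) - real i) * (real (Suc s) + real i + \<alpha> + \<beta> + 1)"
        define B where "B = real (Suc s) * (\<beta> + real (Suc s))"
        have A: "A \<noteq> 0" using False \<alpha>(2) \<beta>1 unfolding A_def by (auto simp del: of_nat_Suc)
        have e: "(2 * real (Suc s) - real j) * (2 * real (Suc s) + real j + real CARD('n) - 2) = 4 * A"
          "2 * real (Suc s) * (2 * real (Suc s) + real CARD('m) - 2) = 4 * B"
        proof -
          have e1: "2 * real (Suc s) - real j = 2 * (real (Suc s) - real i)"
            and e2: "2 * real (Suc s) + real j + real CARD('n) - 2 = 2 * (real (Suc s) + real i + \<alpha> + \<beta> + 1)"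
            and e3: "2 * real (Suc s) + real CARD('m) - 2 = 2 * (\<beta> + real (Suc s))"
            unfolding j \<alpha>(1) \<beta> by (simp_all add: field_simps)
          have h: "(2 * x) * (2 * y) = 4 * (x * y)" for x y :: real by simp
          show "(2 * real (Suc s) - real j) * (2 * real (Suc s) + real j + real CARD('n) - 2) = 4 * A"
            unfolding A_def e1 e2 h ..
          show "2 * real (Suc s) * (2 * real (Suc s) + real CARD('m) - 2) = 4 * B"
            unfolding B_def e3 h ..
        qed
        have "?M (Suc s) = (B / A) *\<^sub>R ?M s"
          using step[of s] False unfolding e by (simp add: j)
        moreover have "jacobi_moment \<alpha> \<beta> i (Suc s) = (B / A) * jacobi_moment \<alpha> \<beta> i s"
          using jacobi_moment_Suc[OF \<alpha>(2) \<beta>1, of s i] A unfolding A_def[symmetric] B_def[symmetric]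
          by (simp add: field_simps)
        ultimately show ?thesis unfolding Suc.IH by (simp add: scaleR_conv_of_real)
      qed (use J in \<open>simp add: C_def\<close>)
    qed
    then show ?thesis using True by (auto simp: i_def)
  next
    case False
    have "?M s = 0" for s
    proof (induction s)
      case 0
      show ?case using M0 False by (cases j) auto
    next
      case (Suc s)
      have "2 * Suc s \<noteq> j" using False by auto
      from step[OF this] show ?case using Suc.IH by simp
    qed
    then show ?thesis using False by simp
  qed
qed

text \<open>
  The even moments of the projected length are the moments of the constant harmonic, which has
  degree \<open>0\<close>; by proportionality they are, up to a factor, those of the weight. The factor is
  fixed by total mass one.
\<close>

lemma distr_norm_vector_matrix_sphere:
  fixes v :: "real ^ 'm ^ 'n"
  assumes v: "v \<in> stiefel" and \<beta>: "\<beta> = real CARD('m) / 2 - 1"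
    and \<alpha>: "\<alpha> = (real CARD('n) - real CARD('m)) / 2 - 1" "\<alpha> > - 1"
  defines "w \<equiv> \<lambda>\<tau>. indicator {0..1} \<tau> * jacobi_weight \<alpha> CARD('m) \<tau>"
  shows "distr sphere_borel borel (\<lambda>x. norm (x v* v)) = density lborel (\<lambda>\<tau>. (2 / Beta (\<beta> + 1) (\<alpha> + 1)) * w \<tau>)"
    and "integrable lborel w" "\<And>\<tau>. w \<tau> \<ge> 0"
proof -
  have \<beta>1: "\<beta> > - 1" using \<beta> by simp
  have m0: "CARD('m) > 0" by simp
  have N: "CARD('n) \<ge> 2"
  proof -
    have "real CARD('n) > real CARD('m)" using \<alpha> by simp
    then show ?thesis using m0 by linarith
  qed
  show w0: "w \<tau> \<ge> 0" for \<tau> by (auto simp: w_def jacobi_weight_def split: split_indicator)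
  have bm: "has_bochner_integral lborel (\<lambda>\<tau>. \<tau> ^ (2 * s) * w \<tau>) (jacobi_moment \<alpha> \<beta> 0 s)" for s
    using has_bochner_integral_jacobi_moment[OF \<alpha>(2) m0 \<beta>, of s 0]
    by (simp add: w_def jacobi_moment_def jacobi_poly_def mult_ac)
  show iw: "integrable lborel w" using bm[of 0] by (simp add: has_bochner_integral_iff)
  define c where "c = 2 / Beta (\<beta> + 1) (\<alpha> + 1)"
  have J0: "jacobi_moment \<alpha> \<beta> 0 0 = 1 / c" "c > 0"
    using jacobi_moment_pos[OF \<alpha>(2) \<beta>1, of 0] by (auto simp: jacobi_moment_def c_def)
  interpret S: prob_space "sphere_borel :: (real ^ 'n) measure" by (rule prob_space_sphere_borel)
  have f [measurable]: "(\<lambda>x. norm (x v* v)) \<in> borel_measurable sphere_borel"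
    using borel_measurable_continuous_onI[OF continuous_on_norm_vector_matrix] by simp
  have hom1: "1 = c ^ 0 *\<^sub>R (1 :: complex)" for c :: real by simp
  have "\<exists>C. \<forall>s. sphere_moment v (\<lambda>x. 1) s = C * of_real (jacobi_moment \<alpha> \<beta> 0 s)"
    using sphere_moment_eq_jacobi_moment[OF v polynomial_function_const hom1 laplacian_const N \<beta> \<alpha>] by simp
  then obtain C where C: "\<And>s. sphere_moment v (\<lambda>x. 1) s = C * of_real (jacobi_moment \<alpha> \<beta> 0 s)" by blast
  have "sphere_moment v (\<lambda>x. 1) 0 = 1" using S.prob_space by (simp add: sphere_moment_def)
  with C[of 0] J0 have Cc: "C = of_real c" by (simp add: field_simps)
  have "distr (density sphere_borel (\<lambda>x. ennreal 1)) borel (\<lambda>x. norm (x v* v)) = density lborel (\<lambda>\<tau>. c * w \<tau>)"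
  proof (rule distr_density_eqI_even_moments[where K=1])
    show "AE x in sphere_borel. norm (x v* v) \<in> {0..1}"
      using AE_sphere_borel_norm by eventually_elim (use norm_vector_matrix_stiefel_le[OF v] in \<open>metis atLeastAtMost_iff norm_ge_zero\<close>)
    fix s
    have "complex_of_real (\<integral>x. norm (x v* v) ^ (2 * s) * 1 \<partial>sphere_borel) = sphere_moment v (\<lambda>x. 1) s"
      unfolding sphere_moment_def
      by (subst integral_complex_of_real[symmetric]) (simp add: proj_sq_eq_norm power_mult)
    also have "\<dots> = of_real (c * jacobi_moment \<alpha> \<beta> 0 s)" unfolding C Cc by simp
    finally have "(\<integral>x. norm (x v* v) ^ (2 * s) * 1 \<partial>sphere_borel) = c * jacobi_moment \<alpha> \<beta> 0 s"
      using of_real_eq_iff by blast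
    also have "\<dots> = (\<integral>\<tau>. c * (\<tau> ^ (2 * s) * w \<tau>) \<partial>lborel)"
      using bm[of s] by (simp add: has_bochner_integral_iff)
    also have "\<dots> = (\<integral>\<tau>. \<tau> ^ (2 * s) * (c * w \<tau>) \<partial>lborel)" by (simp add: mult_ac)
    finally show "(\<integral>x. norm (x v* v) ^ (2 * s) * 1 \<partial>sphere_borel) = (\<integral>\<tau>. \<tau> ^ (2 * s) * (c * w \<tau>) \<partial>lborel)" .
  qed (use iw w0 J0 in \<open>auto simp: w_def S.prob_space_axioms\<close>)
  then show "distr sphere_borel borel (\<lambda>x. norm (x v* v)) = density lborel (\<lambda>\<tau>. (2 / Beta (\<beta> + 1) (\<alpha> + 1)) * w \<tau>)"
    by (simp add: density_1 c_def)
qed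

text \<open>
  Averaging a harmonic over the sets on which the projected length is constant gives a multiple of
  the Jacobi polynomial, with a factor that depends on the harmonic only; it is \<open>0\<close> in odd
  degree. The factor is the same for all profiles \<open>h\<close>, in particular for the profile that
  defines the Stiefel harmonic, and is never computed.
\<close>

lemma zonal_integral_harmonic:
  fixes v :: "real ^ 'm ^ 'n" and p :: "real ^ 'n \<Rightarrow> complex"
  assumes v: "v \<in> stiefel" and \<beta>: "\<beta> = real CARD('m) / 2 - 1"
    and \<alpha>: "\<alpha> = (real CARD('n) - real CARD('m)) / 2 - 1" "\<alpha> > - 1"
    and p: "polynomial_function p" and hom: "\<And>c x. p (c *\<^sub>R x) = c ^ j *\<^sub>R p x" and harm: "\<And>x. laplacian p x = 0"
  defines "w \<equiv> \<lambda>\<tau>. indicator {0..1} \<tau> * jacobi_weight \<alpha> CARD('m) \<tau>"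
  obtains C where "odd j \<Longrightarrow> C = 0"
    and "\<And>h :: real \<Rightarrow> complex. h \<in> borel_measurable borel \<Longrightarrow> integrable lborel (\<lambda>\<tau>. w \<tau> *\<^sub>R h \<tau>) \<Longrightarrow>
       integrable sphere_borel (\<lambda>x. h (norm (x v* v)) * p x) \<and>
       (\<integral>x. h (norm (x v* v)) * p x \<partial>sphere_borel)
         = C * (\<integral>\<tau>. (jacobi_poly \<alpha> \<beta> (j div 2) (2 * \<tau>\<^sup>2 - 1) * w \<tau>) *\<^sub>R h \<tau> \<partial>lborel)"
proof -
  have \<beta>1: "\<beta> > - 1" using \<beta> by simp
  have m0: "CARD('m) > 0" by simp
  have N: "CARD('n) \<ge> 2"
  proof -
    have "real CARD('n) > real CARD('m)" using \<alpha> by simp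
    then show ?thesis using m0 by linarith
  qed
  let ?r = "\<lambda>\<tau>. jacobi_poly \<alpha> \<beta> (j div 2) (2 * \<tau>\<^sup>2 - 1)"
  have pf: "distr sphere_borel borel (\<lambda>x. norm (x v* v)) = density lborel (\<lambda>\<tau>. (2 / Beta (\<beta> + 1) (\<alpha> + 1)) * w \<tau>)"
    "integrable lborel w" "\<And>\<tau>. w \<tau> \<ge> 0"
    unfolding w_def using distr_norm_vector_matrix_sphere[OF v \<beta> \<alpha>] by simp_all
  have "\<exists>C. (odd j \<longrightarrow> C = 0) \<and> (\<forall>s. sphere_moment v p s = C * of_real (jacobi_moment \<alpha> \<beta> (j div 2) s))"
    using sphere_moment_eq_jacobi_moment[OF v p hom harm N \<beta> \<alpha>] by (cases "even j") auto
  then obtain C where C: "odd j \<Longrightarrow> C = 0"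
      "\<And>s. sphere_moment v p s = C * of_real (jacobi_moment \<alpha> \<beta> (j div 2) s)" by blast
  show ?thesis
  proof (rule that[OF C(1)])
    fix h :: "real \<Rightarrow> complex"
    assume h: "h \<in> borel_measurable borel" "integrable lborel (\<lambda>\<tau>. w \<tau> *\<^sub>R h \<tau>)"
    have f: "(\<lambda>x. norm (x v* v)) \<in> borel_measurable sphere_borel"
      using borel_measurable_continuous_onI[OF continuous_on_norm_vector_matrix] by simp
    have f01: "AE x in sphere_borel. norm (x v* v) \<in> {0..1}"
      using AE_sphere_borel_norm by eventually_elim (use norm_vector_matrix_stiefel_le[OF v] in \<open>metis atLeastAtMost_iff norm_ge_zero\<close>)
    have c0: "2 / Beta (\<beta> + 1) (\<alpha> + 1) > 0"
      using jacobi_moment_pos[OF \<alpha>(2) \<beta>1, of 0] by (simp add: jacobi_moment_def)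
    have w1: "w \<tau> = 0" if "\<tau> \<notin> {0..1}" for \<tau> using that by (simp add: w_def)
    have pm: "p \<in> borel_measurable sphere_borel"
      using borel_measurable_continuous_onI[OF continuous_on_polymonial_function[OF p]] by simp
    have "compact (p ` sphere 0 1)"
      using continuous_on_polymonial_function[OF p] by (intro compact_continuous_image) auto
    then obtain Kp where Kp: "\<And>x. x \<in> sphere 0 1 \<Longrightarrow> norm (p x) \<le> Kp"
      using compact_imp_bounded[of "p ` sphere 0 1"] unfolding bounded_iff by blast
    have pK: "AE x in sphere_borel. norm (p x) \<le> Kp"
      using AE_sphere_borel_norm by eventually_elim (use Kp in auto)
    have r: "?r \<in> borel_measurable borel"
      unfolding jacobi_poly_def by measurable
    obtain R where R: "\<And>\<tau>. \<tau> \<in> {0..1} \<Longrightarrow> \<bar>?r \<tau>\<bar> \<le> R"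
      using jacobi_poly_bounded[of \<alpha> \<beta> "j div 2"] by blast
    have mom: "(\<integral>x. of_real (norm (x v* v) ^ (2 * s)) * p x \<partial>sphere_borel)
        = C * of_real (\<integral>\<tau>. \<tau> ^ (2 * s) * (?r \<tau> * w \<tau>) \<partial>lborel)" for s
    proof -
      have "(\<integral>\<tau>. \<tau> ^ (2 * s) * (?r \<tau> * w \<tau>) \<partial>lborel) = jacobi_moment \<alpha> \<beta> (j div 2) s"
        using has_bochner_integral_jacobi_moment[OF \<alpha>(2) m0 \<beta>, of s "j div 2"]
        by (simp add: has_bochner_integral_iff jacobi_moment_def w_def mult_ac)
      then show ?thesis
        using C(2)[of s] by (simp add: sphere_moment_def proj_sq_eq_norm power_mult)
    qed
    note tr = integral_compose_even_moments_complex[OF prob_space_sphere_borel f f01 pf(2,3) w1 c0 pf(1) pm pK r R mom h]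
    show "integrable sphere_borel (\<lambda>x. h (norm (x v* v)) * p x) \<and>
       (\<integral>x. h (norm (x v* v)) * p x \<partial>sphere_borel) = C * (\<integral>\<tau>. (?r \<tau> * w \<tau>) *\<^sub>R h \<tau> \<partial>lborel)"
      using tr by blast
  qed
qed

theorem theorem3p5:
  fixes n k j :: nat
    and v :: "real ^ 'm ^ 'n"
    and a :: "real \<Rightarrow> complex"
    and Y :: "real ^ 'n \<Rightarrow> complex"
  assumes "n \<ge> 2" and "1 \<le> k" and "k \<le> n - 1"
    and "CARD('n) = n + 1" and "CARD('m) = n - k"
    and "v \<in> stiefel"
    and "a \<in> borel_measurable (lebesgue_on {0..1})"
    and "(\<integral>\<^sup>+\<tau>\<in>{0..1}. ennreal (cmod (a \<tau>) * weight n k \<tau>) \<partial>lebesgue) < \<infinity>"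
    and "spherical_harmonic j Y"
  shows "set_integrable sphere_measure (sphere 0 1) (\<lambda>x. a (norm (x v* v)) * Y x) \<and>
         (LINT x:sphere 0 1|sphere_measure. a (norm (x v* v)) * Y x) =
           (if odd j then 0 else multiplier n k a j * stiefel_harmonic n k j Y v)"
proof -
  have k: "1 \<le> k" "k < n" using assms(1-3) by auto
  define \<alpha> where "\<alpha> = (real k - 1) / 2"
  define \<beta> where "\<beta> = (real n - real k) / 2 - 1"
  define w where "w = (\<lambda>\<tau>. indicator {0..1} \<tau> * jacobi_weight \<alpha> CARD('m) \<tau>)"
  define f where "f = (\<lambda>x :: real ^ 'n. norm (x v* v))"
  define P where "P = (\<lambda>\<tau>. jacobi_poly \<alpha> \<beta> (j div 2) (2 * \<tau>\<^sup>2 - 1))"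
  define P1 where "P1 = jacobi_poly \<alpha> \<beta> (j div 2) 1"
  have m0: "CARD('m) > 0" by simp
  have \<beta>: "\<beta> = real CARD('m) / 2 - 1" using k by (simp add: \<beta>_def assms(5) of_nat_diff)
  have \<alpha>: "\<alpha> = (real CARD('n) - real CARD('m)) / 2 - 1" "\<alpha> > - 1"
    using k by (simp_all add: \<alpha>_def assms(4,5) of_nat_diff field_simps)
  have wt: "jacobi_weight \<alpha> CARD('m) \<tau> = weight n k \<tau>" for \<tau>
    by (simp add: jacobi_weight_def weight_def \<alpha>_def assms(5))
  have zo: "zonal n k j \<tau> = P \<tau> / P1" for \<tau>
    by (simp add: zonal_def jacobi_normalized_def P_def P1_def \<alpha>_def \<beta>_def)
  obtain p where p: "polynomial_function p" "\<And>c x. p (c *\<^sub>R x) = c ^ j *\<^sub>R p x"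
    "\<And>x. laplacian p x = 0" and Yp: "\<And>x. x \<in> sphere 0 1 \<Longrightarrow> Y x = p x"
    using assms(9) unfolding spherical_harmonic_def by blast
  have pf: "distr sphere_borel borel f = density lborel (\<lambda>\<tau>. (2 / Beta (\<beta> + 1) (\<alpha> + 1)) * w \<tau>)"
    "integrable lborel w" "\<And>\<tau>. w \<tau> \<ge> 0"
    unfolding w_def f_def using distr_norm_vector_matrix_sphere[OF assms(6) \<beta> \<alpha>] by simp_all
  obtain C where C0: "odd j \<Longrightarrow> C = 0"
    and C: "\<And>h :: real \<Rightarrow> complex. h \<in> borel_measurable borel \<Longrightarrow> integrable lborel (\<lambda>\<tau>. w \<tau> *\<^sub>R h \<tau>) \<Longrightarrow>
       integrable sphere_borel (\<lambda>x. h (f x) * p x) \<and>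
       (\<integral>x. h (f x) * p x \<partial>sphere_borel) = C * (\<integral>\<tau>. (P \<tau> * w \<tau>) *\<^sub>R h \<tau> \<partial>lborel)"
    unfolding w_def f_def P_def using zonal_integral_harmonic[OF assms(6) \<beta> \<alpha> p] by blast
  have fm [measurable]: "f \<in> borel_measurable borel"
    unfolding f_def using continuous_on_norm_vector_matrix by (rule borel_measurable_continuous_onI)
  have pm [measurable]: "p \<in> borel_measurable borel"
    using continuous_on_polymonial_function[OF p(1), of UNIV] by (rule borel_measurable_continuous_onI)
  have Pm [measurable]: "P \<in> borel_measurable borel" unfolding P_def jacobi_poly_def by measurable
  have wm [measurable]: "w \<in> borel_measurable borel" using pf(2) by auto
  obtain R where R: "\<And>\<tau>. \<tau> \<in> {0..1} \<Longrightarrow> \<bar>P \<tau>\<bar> \<le> R"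
    using jacobi_poly_bounded[of \<alpha> \<beta> "j div 2"] unfolding P_def by blast
  have SM: "sphere_measure = completion sphere_borel"
    by (simp add: sphere_measure_def sphere_borel_def)
  \<comment> \<open>Integrals over the completed measure reduce to Borel representatives, and \<open>Y\<close> may be replaced by the polynomial \<open>p\<close>.\<close>
  have tr: "set_integrable sphere_measure (sphere 0 1) G \<longleftrightarrow> integrable sphere_borel (\<lambda>x. h (f x) * p x)"
      "(LINT x:sphere 0 1|sphere_measure. G x) = (\<integral>x. h (f x) * p x \<partial>sphere_borel)"
    if [measurable]: "h \<in> borel_measurable borel" and "AE x in sphere_borel. norm x = 1 \<longrightarrow> G x = h (f x) * p x"
    for G h
  proof -
    have "AE x in sphere_borel. indicator (sphere 0 1) x *\<^sub>R G x = h (f x) * p x"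
      using AE_sphere_borel_norm that(2) by eventually_elim auto
    then show "set_integrable sphere_measure (sphere 0 1) G \<longleftrightarrow> integrable sphere_borel (\<lambda>x. h (f x) * p x)"
      "(LINT x:sphere 0 1|sphere_measure. G x) = (\<integral>x. h (f x) * p x \<partial>sphere_borel)"
      unfolding set_integrable_def set_lebesgue_integral_def SM
      by (intro completion_integral_cong_AE; simp)+
  qed
  obtain a' where a' [measurable]: "a' \<in> borel_measurable borel" and aa': "AE \<tau> in lborel. \<tau> \<in> {0..1} \<longrightarrow> a \<tau> = a' \<tau>"
    using ex_borel_representative[OF assms(7)] by blast
  \<comment> \<open>The law of the projected length has a density, so null sets of profiles pull back to null sets of the sphere.\<close>
  have "AE \<tau> in distr sphere_borel borel f. a \<tau> = a' \<tau>"
    unfolding pf(1)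
  proof (subst AE_density)
    show "AE \<tau> in lborel. 0 < ennreal (2 / Beta (\<beta> + 1) (\<alpha> + 1) * w \<tau>) \<longrightarrow> a \<tau> = a' \<tau>"
      using aa' by eventually_elim (auto simp: w_def split: split_indicator_asm)
  qed measurable
  then have af: "AE x in sphere_borel. a (f x) = a' (f x)"
    by (rule AE_distrD[rotated]) simp
  have iwa: "integrable lborel (\<lambda>\<tau>. w \<tau> *\<^sub>R a' \<tau>)"
    unfolding integrable_iff_bounded
  proof
    have "(\<integral>\<^sup>+ \<tau>. ennreal (norm (w \<tau> *\<^sub>R a' \<tau>)) \<partial>lborel)
        = (\<integral>\<^sup>+ \<tau>. ennreal (cmod (a \<tau>) * weight n k \<tau>) * indicator {0..1} \<tau> \<partial>lborel)"
      using aa'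
      by (intro nn_integral_cong_AE) (auto elim!: eventually_mono simp: w_def wt weight_def split: split_indicator simp: abs_mult mult_ac)
    also have "\<dots> = (\<integral>\<^sup>+\<tau>\<in>{0..1}. ennreal (cmod (a \<tau>) * weight n k \<tau>) \<partial>lebesgue)"
      by (simp add: nn_integral_completion)
    finally show "(\<integral>\<^sup>+ \<tau>. ennreal (norm (w \<tau> *\<^sub>R a' \<tau>)) \<partial>lborel) < \<infinity>" using assms(8) by simp
  qed measurable
  have afY: "AE x in sphere_borel. norm x = 1 \<longrightarrow> a (norm (x v* v)) * Y x = a' (f x) * p x"
    using af by eventually_elim (auto simp: f_def Yp)
  note tra = tr[OF a' afY]
  have main: "set_integrable sphere_measure (sphere 0 1) (\<lambda>x. a (norm (x v* v)) * Y x)"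
    "(LINT x:sphere 0 1|sphere_measure. a (norm (x v* v)) * Y x) = C * (\<integral>\<tau>. (P \<tau> * w \<tau>) *\<^sub>R a' \<tau> \<partial>lborel)"
    using tra C[OF a' iwa] by auto
  show ?thesis
  proof (cases "odd j")
    case True
    then show ?thesis using main C0 by simp
  next
    case False
    define i where "i = j div 2"
    have j: "j = 2 * i" using False by (simp add: i_def)
    define c where "c = sphere_area (n - k - 1) * sphere_area k / sphere_area n"
    define Q where "Q = ((2 * real i + \<alpha> + \<beta>) gchoose i) * Beta (\<beta> + 1 + real i) (\<alpha> + 1 + real i) / 2"
    \<comment> \<open>\<open>Q\<close> is the squared norm of the Jacobi polynomial with value \<open>P1\<close> at \<open>1\<close>.\<close>
    have kap: "(kappa n k j)\<^sup>2 * c * Q = P1\<^sup>2"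
      using kappa_normalization[OF k, of i] unfolding c_def Q_def P1_def \<alpha>_def \<beta>_def j by simp
    have P1: "P1 \<noteq> 0"
      unfolding P1_def jacobi_poly_1 using \<alpha>(2)
      by (subst gbinomial_Gamma_pos) (auto simp: Gamma_real_pos order.strict_implies_not_eq[OF Gamma_real_pos, symmetric])
    have hd: "harm_dim n j > 0"
      unfolding harm_dim_def using assms(1) by (intro mult_pos_pos divide_pos_pos Gamma_real_pos) auto
    define I where "I = (\<integral>\<tau>. (P \<tau> * w \<tau>) *\<^sub>R a' \<tau> \<partial>lborel)"
    have PQ: "(\<integral>\<tau>. (P \<tau>)\<^sup>2 * w \<tau> \<partial>lborel) = Q"
      using has_bochner_integral_jacobi_sq[OF \<alpha>(2) m0 \<beta>, of i]
      by (simp add: has_bochner_integral_iff P_def w_def Q_def i_def mult_ac)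
    \<comment> \<open>The same formula with the zonal profile instead of \<open>a\<close> evaluates the Stiefel harmonic as a multiple of the unknown factor \<open>C\<close>.\<close>
    let ?h = "\<lambda>\<tau>. complex_of_real (P \<tau> / P1)"
    have hm: "?h \<in> borel_measurable borel" by measurable
    have hi: "integrable lborel (\<lambda>\<tau>. w \<tau> *\<^sub>R ?h \<tau>)"
    proof (rule Bochner_Integration.integrable_bound)
      show "integrable lborel (\<lambda>\<tau>. (R / P1) * w \<tau>)" using pf(2) by simp
      show "AE \<tau> in lborel. norm (w \<tau> *\<^sub>R ?h \<tau>) \<le> norm ((R / P1) * w \<tau>)"
      proof (rule AE_I2)
        fix \<tau> :: real
        show "norm (w \<tau> *\<^sub>R ?h \<tau>) \<le> norm ((R / P1) * w \<tau>)"
        proof (cases "\<tau> \<in> {0..1}")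
          case True
          have "\<bar>P \<tau>\<bar> / \<bar>P1\<bar> * \<bar>w \<tau>\<bar> \<le> \<bar>R\<bar> / \<bar>P1\<bar> * \<bar>w \<tau>\<bar>"
            using R[OF True] by (intro mult_right_mono divide_right_mono) auto
          then show ?thesis by (simp add: abs_mult norm_divide mult_ac)
        qed (simp add: w_def)
      qed
    qed measurable
    have "AE x in sphere_borel. norm x = 1 \<longrightarrow> zonal n k j (norm (x v* v)) *\<^sub>R Y x = ?h (f x) * p x"
      by (rule AE_I2) (simp add: zo f_def Yp scaleR_conv_of_real)
    from tr(2)[OF hm this] C[OF hm hi]
    have "(LINT x:sphere 0 1|sphere_measure. zonal n k j (norm (x v* v)) *\<^sub>R Y x)
        = C * (\<integral>\<tau>. (P \<tau> * w \<tau>) *\<^sub>R ?h \<tau> \<partial>lborel)" by simp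
    also have "(\<integral>\<tau>. (P \<tau> * w \<tau>) *\<^sub>R ?h \<tau> \<partial>lborel) = (\<integral>\<tau>. complex_of_real ((1 / P1) * ((P \<tau>)\<^sup>2 * w \<tau>)) \<partial>lborel)"
      by (intro Bochner_Integration.integral_cong) (auto simp: scaleR_conv_of_real power2_eq_square)
    also have "\<dots> = complex_of_real (Q / P1)"
      unfolding integral_complex_of_real by (simp only: integral_mult_right_zero PQ) simp
    finally have st: "stiefel_harmonic n k j Y v = of_real (kappa n k j * sqrt (harm_dim n j)) * (C * of_real (Q / P1))"
      unfolding stiefel_harmonic_def by (simp add: scaleR_conv_of_real)
    have "(LINT \<tau>:{0..1}|lebesgue. (zonal n k j \<tau> * weight n k \<tau>) *\<^sub>R a \<tau>) = (\<integral>\<tau>. (1 / P1) *\<^sub>R ((P \<tau> * w \<tau>) *\<^sub>R a' \<tau>) \<partial>lborel)"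
      unfolding set_lebesgue_integral_def
    proof (rule completion_integral_cong_AE(3))
      show "AE \<tau> in lborel. indicator {0..1} \<tau> *\<^sub>R (zonal n k j \<tau> * weight n k \<tau>) *\<^sub>R a \<tau> = (1 / P1) *\<^sub>R ((P \<tau> * w \<tau>) *\<^sub>R a' \<tau>)"
        using aa' by eventually_elim (auto simp: zo w_def wt split: split_indicator)
    qed measurable
    also have "\<dots> = (1 / P1) *\<^sub>R I" unfolding I_def by (rule integral_scaleR_right)
    finally have mu: "multiplier n k a j = of_real (kappa n k j * c / sqrt (harm_dim n j)) * (of_real (1 / P1) * I)"
      unfolding multiplier_def c_def by (simp add: scaleR_conv_of_real mult_ac)
    have "multiplier n k a j * stiefel_harmonic n k j Y v
        = of_real ((kappa n k j * c / sqrt (harm_dim n j)) * (kappa n k j * sqrt (harm_dim n j)) * (1 / P1) * (Q / P1)) * (C * I)"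
      unfolding mu st by (simp add: mult_ac)
    also have "(kappa n k j * c / sqrt (harm_dim n j)) * (kappa n k j * sqrt (harm_dim n j)) * (1 / P1) * (Q / P1)
        = ((kappa n k j)\<^sup>2 * c * Q) / P1\<^sup>2"
      using hd by (simp add: power2_eq_square)
    also have "\<dots> = 1" unfolding kap using P1 by simp
    finally show ?thesis using main False by (simp add: I_def)
  qed
qed

end
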